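(* Let $n\ge 1$ and $k\ge 1$ be integers, let $c>0$ be real, and let $p:\mathbb{R}\to\mathbb{R}$ be a polynomial of degree $d$ such that (1) $0 \le p(i) \le 1$ for every $i = 0,1,\dots,n$, and (2) $\sup_{x\in[0,n]} |p^{(k)}(x)| \geq c$. Then either $d^2 \geq \sqrt{6}\, n$, or the ratio $x = d^2/n$ satisfies \[ \left(1 - \frac{x^2}{6}\right)\frac{(2k-1)!!}{2^{k-1}}\, c < x^k, \] where $(2k-1)!! = (2k-1)(2k-3)\cdots 3\cdot 1$.
   Context: $p^{(k)}$ denotes the $k$-th derivative of $p$. *)

theory Defs
  imports "HOL-Analysis.Analysis" "HOL-Computational_Algebra.Polynomial"
begin

definition odd_double_fact :: "nat \<Rightarrow> nat" where
  "odd_double_fact k = (\<Prod>i\<in>{1..k}. 2 * i - 1)"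

end

theory Submission
  imports Defs "HOL-Complex_Analysis.Complex_Analysis"
    "HOL-Computational_Algebra.Fundamental_Theorem_Algebra"
begin

text \<open>
  Put \<open>q = p - 1/2\<close> and let \<open>M\<close> be the maximum of \<open>|q|\<close> on \<open>[0, n]\<close>. The inequality of V. A. Markov bounds
  \<open>|q\<^sup>(\<^sup>k\<^sup>)|\<close> by \<open>M (2/n)\<^sup>k T\<^sub>d\<^sup>(\<^sup>k\<^sup>)(1) \<le> M (2/n)\<^sup>k d\<^sup>2\<^sup>k / (2k-1)!!\<close>, where \<open>T\<^sub>d\<close> is the Chebyshev polynomial. For
  \<open>k = 2\<close>, a Taylor expansion at a maximum point of \<open>|q|\<close>, evaluated at the nearest integer, turns this
  into \<open>M (1 - x\<^sup>2/6) < 1/2\<close>; inserting this in the bound for general \<open>k\<close> gives the claim.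

  Markov's inequality is proved following Duffin and Schaeffer. If a polynomial \<open>f\<close> has all its roots
  in the left half-plane and \<open>|g| \<le> |f|\<close> on the imaginary axis, \<open>deg g \<le> deg f\<close>, then \<open>|g'| \<le> |f'|\<close> there
  (maximum principle and Gauss-Lucas theorem). Hence it suffices to show
  \<open>|p'(a + \<i>y)| \<le> |T\<^sub>d'(1 + \<i>y)|\<close> for \<open>|a| \<le> 1\<close> and all real \<open>y\<close>. Lagrange interpolation at the extremal points
  of \<open>T\<^sub>d\<close> gives \<open>|p'| \<le> |T\<^sub>d'|\<close> at the roots of \<open>T\<^sub>d\<close>. Interpolating \<open>p'\<close> at these roots and reflecting them to
  the left of \<open>a\<close> reduces the claim, by the half-plane principle, to \<open>|T\<^sub>d(a + \<i>y)| \<le> |T\<^sub>d(1 + \<i>y)|\<close>, which follows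
  from a coefficientwise comparison of generating functions.
\<close>

section \<open>Polynomials\<close>

text \<open>Both sides have the same coefficient at \<open>card S\<close> and agree on
  \<open>S\<close>, so their difference has too many zeros to be nonzero.\<close>

lemma poly_eq_smult_prod_roots:
  fixes p :: "'a::field poly"
  assumes "finite S" "degree p = card S" "\<And>s. s \<in> S \<Longrightarrow> poly p s = 0"
  shows "p = smult (lead_coeff p) (\<Prod>s\<in>S. [:-s, 1:])"
proof (rule poly_eqI_degree_lead_coeff[of _ "card S" _ S])
  have "degree (\<Prod>s\<in>S. [:-s, 1:]) = card S"
    by (subst degree_prod_eq_sum_degree) auto
  moreover have "lead_coeff (\<Prod>s\<in>S. [:-s, 1:]) = 1"
    by (simp add: lead_coeff_prod)
  ultimately show "coeff p (card S) = coeff (smult (lead_coeff p) (\<Prod>s\<in>S. [:- s, 1:])) (card S)"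
    "degree (smult (lead_coeff p) (\<Prod>s\<in>S. [:- s, 1:])) \<le> card S"
    using assms(2) by auto
  show "poly p z = poly (smult (lead_coeff p) (\<Prod>s\<in>S. [:- s, 1:])) z" if "z \<in> S" for z
    using that assms by (auto simp: poly_prod prod_zero_iff)
qed (use assms in auto)

lemma lagrange_interpolation:
  fixes p :: "'a::field poly"
  assumes "finite S" "degree p < card S"
  shows "p = (\<Sum>s\<in>S. smult (poly p s / (\<Prod>t\<in>S-{s}. s - t)) (\<Prod>t\<in>S-{s}. [:-t, 1:]))"
    (is "p = ?q")
proof (rule poly_eqI_degree[of S])
  show "poly p x = poly ?q x" if "x \<in> S" for x
  proof -
    have "poly ?q x = (\<Sum>s\<in>S. poly p s / (\<Prod>t\<in>S-{s}. s - t) * (\<Prod>t\<in>S-{s}. x - t))"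
      by (simp add: poly_sum poly_prod)
    also have "\<dots> = (\<Sum>s\<in>{x}. poly p s / (\<Prod>t\<in>S-{s}. s - t) * (\<Prod>t\<in>S-{s}. x - t))"
      using assms(1) that by (intro sum.mono_neutral_right) (auto simp: prod_zero_iff)
    also have "\<dots> = poly p x"
      using assms(1) by (simp add: prod_zero_iff)
    finally show ?thesis ..
  qed
  have "degree ?q \<le> card S - 1"
  proof (rule degree_sum_le[OF assms(1)])
    fix s assume "s \<in> S"
    then show "degree (smult (poly p s / (\<Prod>t\<in>S-{s}. s - t)) (\<Prod>t\<in>S-{s}. [:-t, 1:])) \<le> card S - 1"
      by (intro order_trans[OF degree_smult_le] order_trans[OF degree_prod_sum_le])
         (use assms(1) in auto)
  qed
  then show "card S > degree ?q" using assms(2) by linarith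
qed (use assms in auto)

lemma pderiv_sum: "pderiv (\<Sum>i\<in>A. f i) = (\<Sum>i\<in>A. pderiv (f i))"
  by (induction A rule: infinite_finite_induct) (simp_all add: pderiv_add)

lemma higher_pderiv_pcompose_linear:
  "(pderiv ^^ k) (pcompose p [:a, b:]) = smult (b ^ k) (pcompose ((pderiv ^^ k) p) [:a, b:])"
  for p :: "'a::{comm_semiring_1,semiring_no_zero_divisors} poly"
  by (induction k) (simp_all add: pderiv_smult pderiv_pcompose pderiv_pCons mult_ac)

section \<open>Passage from real to complex polynomials\<close>

abbreviation complexify :: "real poly \<Rightarrow> complex poly" where
  "complexify \<equiv> map_poly complex_of_real"

lemma complexify_add: "complexify (p + q) = complexify p + complexify q"
  by (rule poly_eqI) (simp add: coeff_map_poly)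

lemma complexify_diff: "complexify (p - q) = complexify p - complexify q"
  by (rule poly_eqI) (simp add: coeff_map_poly)

lemma complexify_smult: "complexify (smult a p) = smult (of_real a) (complexify p)"
  by (rule poly_eqI) (simp add: coeff_map_poly)

lemma complexify_mult: "complexify (p * q) = complexify p * complexify q"
  by (rule poly_eqI) (simp add: coeff_map_poly coeff_mult)

lemma complexify_sum: "complexify (\<Sum>i\<in>A. f i) = (\<Sum>i\<in>A. complexify (f i))"
  by (induction A rule: infinite_finite_induct) (simp_all add: complexify_add)

lemma complexify_prod: "complexify (\<Prod>i\<in>A. f i) = (\<Prod>i\<in>A. complexify (f i))"
  by (induction A rule: infinite_finite_induct) (simp_all add: complexify_mult)

lemma complexify_pderiv: "complexify (pderiv p) = pderiv (complexify p)"
  by (rule poly_eqI) (simp add: coeff_map_poly coeff_pderiv)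

lemma complexify_higher_pderiv: "complexify ((pderiv ^^ k) p) = (pderiv ^^ k) (complexify p)"
  by (induction k) (simp_all add: complexify_pderiv)

lemma poly_complexify: "poly (complexify p) (of_real x) = of_real (poly p x)"
  by (induction p) (simp_all add: map_poly_pCons)

lemma degree_complexify [simp]: "degree (complexify p) = degree p"
  by (rule degree_map_poly) simp

section \<open>Polynomials without roots in the right half-plane\<close>

text \<open>The logarithmic derivative is the sum of \<open>1 / (z - a)\<close> over the roots
  \<open>a\<close>, and each term has positive real part because \<open>Re a < 0 <= Re z\<close>.
  The induction splits off one root at a time.\<close>

lemma Re_logderiv_pos:
  fixes f :: "complex poly"
  assumes "\<And>z. poly f z = 0 \<Longrightarrow> Re z < 0" "degree f > 0" "Re z \<ge> 0"
  shows "Re (poly (pderiv f) z / poly f z) > 0"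
  using assms
proof (induction "degree f" arbitrary: f)
  case 0
  then show ?case by simp
next
  case (Suc m)
  have "\<not> constant (poly f)"
    using Suc.prems(2) by (simp add: constant_degree)
  then obtain a where a: "poly f a = 0"
    using fundamental_theorem_of_algebra by blast
  then obtain q where f: "f = [:-a, 1:] * q"
    by (auto simp: poly_eq_0_iff_dvd dvd_def)
  have q0: "q \<noteq> 0"
    using Suc.prems(2) f by auto
  have dq: "degree q = m"
    using Suc.hyps(2) q0 unfolding f by (subst (asm) degree_mult_eq) auto
  have ra: "Re a < 0"
    using a Suc.prems(1) by blast
  have rq: "Re w < 0" if "poly q w = 0" for w
    using Suc.prems(1)[of w] that f by simp
  have nz: "z - a \<noteq> 0" "poly q z \<noteq> 0"
    using ra rq[of z] \<open>Re z \<ge> 0\<close> by auto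
  have "pderiv f = q + [:-a, 1:] * pderiv q"
    unfolding f by (subst pderiv_mult) (simp add: pderiv_pCons)
  then have "poly (pderiv f) z = poly q z + (z - a) * poly (pderiv q) z"
    by (simp add: left_diff_distrib)
  moreover have "poly f z = (z - a) * poly q z"
    by (simp add: f algebra_simps)
  ultimately have "poly (pderiv f) z / poly f z = 1 / (z - a) + poly (pderiv q) z / poly q z"
    using nz by (simp add: add_divide_distrib)
  moreover have "Re (1 / (z - a)) > 0"
    using ra \<open>Re z \<ge> 0\<close> nz(1)
    by (simp add: Re_divide divide_pos_pos sum_power2_gt_zero_iff complex_eq_iff)
  \<comment> \<open>Only a weak inequality, since the cofactor may be constant; strictness comes
    from the root split off.\<close>
  moreover have "Re (poly (pderiv q) z / poly q z) \<ge> 0"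
  proof (cases "m = 0")
    case True
    then have "pderiv q = 0" using dq by (simp add: pderiv_eq_0_iff)
    then show ?thesis by simp
  next
    case False
    then show ?thesis using Suc.hyps(1)[of q] dq rq \<open>Re z \<ge> 0\<close> by force
  qed
  ultimately show ?case by simp
qed

text \<open>Gauss-Lucas for a half-plane: at a critical point the logarithmic derivative is 0, so
  its real part is not positive.\<close>

lemma pderiv_roots_left_half_plane:
  fixes f :: "complex poly"
  assumes "\<And>z. poly f z = 0 \<Longrightarrow> Re z < 0" "degree f > 0" "poly (pderiv f) z = 0"
  shows "Re z < 0"
  using Re_logderiv_pos[OF assms(1,2), of z] assms(3) by force

text \<open>The quotient \<open>g / f\<close> is holomorphic on the right half-plane, has modulus at
  most 1 on the boundary and a finite limit at infinity, so the maximum principle on large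
  half-discs applies.\<close>

lemma norm_le_right_half_plane:
  fixes f g :: "complex poly"
  assumes roots: "\<And>z. poly f z = 0 \<Longrightarrow> Re z < 0" and deg: "degree g \<le> degree f"
    and le: "\<And>y. norm (poly g (\<i> * of_real y)) \<le> norm (poly f (\<i> * of_real y))"
    and z: "Re z \<ge> 0"
  shows "norm (poly g z) \<le> norm (poly f z)"
proof -
  define h where "h = (\<lambda>z. poly g z / poly f z)"
  have f0: "f \<noteq> 0" using roots[of 1] by auto
  \<comment> \<open>The limit of \<open>g / f\<close> at infinity. Taking the coefficient at
    \<open>degree f\<close> makes it 0 when \<open>g\<close> has smaller degree.\<close>
  define c where "c = coeff g (degree f) / lead_coeff f"
  define r where "r = g - smult c f"
  have hlim: "(h \<longlongrightarrow> c) at_infinity"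
  proof (cases "degree f = 0")
    case True
    then obtain a b where "f = [:a:]" "g = [:b:]"
      using deg by (metis degree_eq_zeroE le_zero_eq)
    then show ?thesis by (simp add: h_def c_def)
  next
    case False
    have "coeff r (degree f) = 0"
      using f0 by (simp add: r_def c_def)
    moreover have "degree r \<le> degree f"
      using deg by (simp add: r_def degree_diff_le)
    ultimately have "degree r < degree f"
      using False by (metis eq_zero_or_degree_less degree_0 not_gr_zero)
    then have "((\<lambda>z. poly r z / poly f z) \<longlongrightarrow> 0) at_infinity"
      by (rule poly_divide_tendsto_0_at_infinity)
    then have "((\<lambda>z. c + poly r z / poly f z) \<longlongrightarrow> c + 0) at_infinity"
      by (intro tendsto_intros)
    moreover have "\<forall>\<^sub>F z in at_infinity. c + poly r z / poly f z = h z"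
    proof -
      have "finite {z. poly f z = 0}" by (rule poly_roots_finite[OF f0])
      then obtain B where "\<And>z. poly f z = 0 \<Longrightarrow> norm z < B"
        by (metis (mono_tags) bounded_pos_less finite_imp_bounded mem_Collect_eq)
      then show ?thesis
        unfolding eventually_at_infinity
        by (intro exI[of _ B]) (fastforce simp: h_def r_def diff_divide_distrib)
    qed
    ultimately show ?thesis
      by (simp add: tendsto_cong)
  qed
  have f_nz: "poly f w \<noteq> 0" if "Re w \<ge> 0" for w
    using roots[of w] that by auto
  have h_axis: "norm (h w) \<le> 1" if "Re w = 0" for w
  proof -
    have "w = \<i> * of_real (Im w)" using that by (simp add: complex_eq_iff)
    then show ?thesis
      using le[of "Im w"] f_nz[of w] that by (simp add: h_def norm_divide)
  qed
  \<comment> \<open>The limit can be taken along the imaginary axis, where the quotient has modulus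
    at most 1.\<close>
  have c1: "norm c \<le> 1"
  proof (rule tendsto_upperbound)
    have "filterlim (\<lambda>n. \<i> * of_real (real n)) at_infinity sequentially"
      unfolding filterlim_at_infinity_conv_norm_at_top
      by (simp add: norm_mult filterlim_real_sequentially)
    then show "((\<lambda>n. norm (h (\<i> * of_real (real n)))) \<longlongrightarrow> norm c) sequentially"
      by (intro tendsto_norm filterlim_compose[OF hlim])
    show "\<forall>\<^sub>F n in sequentially. norm (h (\<i> * of_real (real n))) \<le> 1"
      using h_axis by simp
  qed simp
  have "norm (h z) \<le> 1 + e" if e: "e > 0" for e
  proof -
    obtain B where B: "\<And>w. norm w \<ge> B \<Longrightarrow> dist (h w) c < e"
      using hlim e unfolding tendsto_iff eventually_at_infinity by blast
    \<comment> \<open>Radius at least \<open>B\<close> keeps the quotient within \<open>e\<close> of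
      \<open>c\<close> on the arc; \<open>norm z + 1\<close> puts \<open>z\<close> inside the
      half-disc.\<close>
    define R where "R = max B (norm z + 1)"
    define S where "S = {w. Re w \<ge> 0} \<inter> cball 0 R"
    have clS: "closed S"
      unfolding S_def by (intro closed_Int closed_halfspace_Re_ge closed_cball)
    have op: "{w. Re w > 0} \<inter> ball 0 R \<subseteq> interior S"
      by (rule interior_maximal) (auto simp: S_def open_halfspace_Re_gt)
    show ?thesis
    proof (rule maximum_modulus_frontier[of h S])
      show "h holomorphic_on interior S"
        unfolding h_def by (intro holomorphic_intros) (use interior_subset[of S] f_nz in \<open>auto simp: S_def\<close>)
      show "continuous_on (closure S) h"
        unfolding h_def closure_closed[OF clS]
        by (intro continuous_intros) (use f_nz in \<open>auto simp: S_def\<close>)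
      show "bounded S"
        by (auto simp: S_def intro: bounded_subset[OF bounded_cball])
      show "z \<in> S" using z by (simp add: S_def R_def)
      show "norm (h w) \<le> 1 + e" if "w \<in> frontier S" for w
      proof -
        have "w \<in> S" "w \<notin> interior S"
          using that clS by (auto simp: frontier_def)
        then have "Re w = 0 \<or> norm w = R"
          using op by (force simp: S_def)
        then show ?thesis
        proof
          assume "Re w = 0"
          then show ?thesis using h_axis[of w] e by simp
        next
          assume "norm w = R"
          then have "dist (h w) c < e" using B by (simp add: R_def)
          then show ?thesis using c1 norm_triangle_sub[of "h w" c] by (simp add: dist_norm)
        qed
      qed
    qed
  qed
  then have "norm (h z) \<le> 1" by (rule field_le_epsilon)
  then show ?thesis
    using f_nz[OF z] by (simp add: h_def norm_divide)
qed

text \<open>If the bound failed at \<open>w\<close>, some \<open>l\<close> with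
  \<open>norm l < 1\<close> would make \<open>w\<close> a critical point of \<open>f - l g\<close>.
  But \<open>|g| <= |f|\<close> on the right half-plane keeps all roots of \<open>f - l g\<close> on
  the left, contradicting Gauss-Lucas.\<close>

lemma norm_pderiv_le_imaginary_axis:
  fixes f g :: "complex poly"
  assumes roots: "\<And>z. poly f z = 0 \<Longrightarrow> Re z < 0" and deg: "degree g \<le> degree f"
    and le: "\<And>y. norm (poly g (\<i> * of_real y)) \<le> norm (poly f (\<i> * of_real y))"
  shows "norm (poly (pderiv g) (\<i> * of_real y)) \<le> norm (poly (pderiv f) (\<i> * of_real y))"
proof (rule ccontr)
  assume asm: "\<not> ?thesis"
  define w where "w = \<i> * complex_of_real y"
  define l where "l = poly (pderiv f) w / poly (pderiv g) w"
  have gw: "poly (pderiv g) w \<noteq> 0" using asm by (auto simp: w_def)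
  have l1: "norm l < 1" using asm gw by (simp add: l_def norm_divide w_def)
  define h where "h = f - smult l g"
  have f_nz: "poly f z \<noteq> 0" if "Re z \<ge> 0" for z using roots[of z] that by auto
  have hroots: "Re z < 0" if "poly h z = 0" for z
  proof (rule ccontr)
    assume "\<not> Re z < 0"
    then have z: "Re z \<ge> 0" by simp
    have "norm (poly f z) = norm l * norm (poly g z)"
      using that by (simp add: h_def flip: norm_mult)
    also have "\<dots> \<le> norm l * norm (poly f z)"
      using norm_le_right_half_plane[OF roots deg le z] by (simp add: mult_left_mono)
    also have "\<dots> < 1 * norm (poly f z)"
      using l1 f_nz[OF z] by (intro mult_strict_right_mono) auto
    finally show False by simp
  qed
  have "poly (pderiv h) w = 0"
    using gw by (simp add: h_def pderiv_diff pderiv_smult l_def)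
  \<comment> \<open>Gauss-Lucas needs \<open>h\<close> nonconstant. If \<open>f = l g + a\<close>,
    then \<open>|g| <= |f| <= |l| |g| + |a|\<close> bounds the nonconstant \<open>g\<close> on the
    right half-plane, which is impossible.\<close>
  moreover have "degree h > 0"
  proof (rule ccontr)
    assume "\<not> degree h > 0"
    then have h0: "pderiv h = 0" by (simp add: pderiv_eq_0_iff)
    have dg: "degree g > 0" using gw by (metis gr0I pderiv_eq_0_iff poly_0)
    obtain a where a: "f = smult l g + [:a:]"
    proof -
      have "degree h = 0" using h0 by (simp add: pderiv_eq_0_iff)
      then obtain a where "h = [:a:]" by (rule degree_eq_zeroE)
      then show ?thesis using that[of a] by (simp add: h_def algebra_simps)
    qed
    have "norm (poly g z) \<le> norm a / (1 - norm l)" if "Re z \<ge> 0" for z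
    proof -
      have "norm (poly g z) \<le> norm (poly f z)"
        by (rule norm_le_right_half_plane[OF roots deg le that])
      also have "\<dots> \<le> norm l * norm (poly g z) + norm a"
        unfolding a by (simp add: norm_triangle_le norm_mult)
      finally show ?thesis using l1 by (simp add: field_simps)
    qed
    moreover obtain r where r: "\<And>z. r \<le> norm z \<Longrightarrow> norm a / (1 - norm l) + 1 \<le> norm (poly g z)"
    proof -
      obtain b q where gq: "g = pCons b q" by (cases g)
      then have "q \<noteq> 0" using dg by auto
      then show ?thesis using poly_infinity[of q "norm a / (1 - norm l) + 1" b] that gq by blast
    qed
    ultimately show False
      using r[of "of_real \<bar>r\<bar>"] by (metis Re_complex_of_real abs_ge_self abs_ge_zero add.commute
        add_le_same_cancel2 norm_of_real abs_abs not_one_le_zero order_trans)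
  qed
  ultimately have "Re w < 0"
    using pderiv_roots_left_half_plane[of h w] hroots by blast
  then show False by (simp add: w_def)
qed

text \<open>Gauss-Lucas passes the root hypothesis on to derivatives, so the comparison can be
  iterated.\<close>

lemma norm_higher_pderiv_le_imaginary_axis:
  fixes f g :: "complex poly"
  assumes "\<And>z. poly f z = 0 \<Longrightarrow> Re z < 0" "degree g \<le> degree f"
    and "\<And>y. norm (poly g (\<i> * of_real y)) \<le> norm (poly f (\<i> * of_real y))"
    and "j \<le> degree f"
  shows "norm (poly ((pderiv ^^ j) g) (\<i> * of_real y)) \<le> norm (poly ((pderiv ^^ j) f) (\<i> * of_real y))"
  using assms
proof (induction j arbitrary: f g)
  case (Suc j)
  have "norm (poly ((pderiv ^^ j) (pderiv g)) (\<i> * of_real y))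
      \<le> norm (poly ((pderiv ^^ j) (pderiv f)) (\<i> * of_real y))"
  proof (rule Suc.IH)
    show "Re z < 0" if "poly (pderiv f) z = 0" for z
      using pderiv_roots_left_half_plane[of f z] Suc.prems that by auto
    show "degree (pderiv g) \<le> degree (pderiv f)" "j \<le> degree (pderiv f)"
      using Suc.prems(2,4) by (auto simp: degree_pderiv)
    show "norm (poly (pderiv g) (\<i> * of_real y)) \<le> norm (poly (pderiv f) (\<i> * of_real y))" for y
      by (rule norm_pderiv_le_imaginary_axis) (use Suc.prems in auto)
  qed
  then show ?case by (simp add: funpow_swap1)
qed simp

section \<open>Chebyshev polynomials\<close>

text \<open>Polymorphic, so that one name serves for the real polynomial and its
  complexification.\<close>

fun cheb :: "nat \<Rightarrow> 'a::comm_ring_1 poly" where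
  "cheb 0 = 1"
| "cheb (Suc 0) = [:0, 1:]"
| "cheb (Suc (Suc n)) = [:0, 2:] * cheb (Suc n) - cheb n"

lemma poly_cheb_cos:
  fixes w :: "'a::{real_normed_field,banach}"
  shows "poly (cheb n) (cos w) = cos (of_nat n * w)"
proof (induction n rule: cheb.induct)
  case (3 n)
  have "cos (of_nat (Suc (Suc n)) * w) + cos (of_nat n * w) =
      cos (of_nat (Suc n) * w + w) + cos (of_nat (Suc n) * w - w)"
    by (simp add: algebra_simps)
  also have "\<dots> = 2 * cos w * cos (of_nat (Suc n) * w)"
    unfolding cos_add cos_diff by (simp add: algebra_simps)
  finally show ?case
    using 3 by (simp add: algebra_simps)
qed simp_all

lemma degree_cheb_le: "degree (cheb n) \<le> n"
proof (induction n rule: cheb.induct)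
  case (3 n)
  have "degree ([:0, 2:] * cheb (Suc n) :: 'a poly) \<le> 1 + Suc n"
    using 3(1) by (intro order_trans[OF degree_mult_le] add_mono) auto
  then show ?case
    using 3(2) by (auto intro!: degree_diff_le)
qed auto

lemma coeff_cheb: "coeff (cheb n) n = 2 ^ (n - 1)"
proof (induction n rule: cheb.induct)
  case (3 n)
  have "coeff (cheb n :: 'a poly) (Suc (Suc n)) = 0"
    using degree_cheb_le[of n, where 'a='a] by (intro coeff_eq_0) linarith
  then show ?case
    using 3(1) by simp
qed auto

lemma degree_cheb [simp]: "degree (cheb n :: 'a::{idom,ring_char_0} poly) = n"
  using le_degree[of "cheb n :: 'a poly" n] degree_cheb_le[of n, where 'a='a]
  by (simp add: coeff_cheb)

lemma sin_mult_pderiv_cheb: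
  "sin t * poly (pderiv (cheb n)) (cos t) = real n * sin (real n * t)" for t :: real
proof -
  have "((\<lambda>t. poly (cheb n) (cos t)) has_real_derivative - sin t * poly (pderiv (cheb n)) (cos t)) (at t)"
    by (auto intro!: derivative_eq_intros)
  moreover have "((\<lambda>t. poly (cheb n) (cos t)) has_real_derivative - (real n * sin (real n * t))) (at t)"
    unfolding poly_cheb_cos by (auto intro!: derivative_eq_intros)
  ultimately show ?thesis using DERIV_unique by fastforce
qed

text \<open>Differentiating \<open>sin t * T'(cos t) = n * sin (n * t)\<close> gives the equation at
  every \<open>x = cos t\<close>, and a polynomial vanishing on \<open>[-1, 1]\<close> is
  zero.\<close>

lemma cheb_ode:
  "[:1, 0, -1:] * pderiv (pderiv (cheb n)) - [:0, 1:] * pderiv (cheb n)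
     + smult (real n ^ 2) (cheb n) = 0" (is "?L = 0")
proof (rule ccontr)
  assume nz: "?L \<noteq> 0"
  define T where "T = (cheb n :: real poly)"
  have 2: "cos t * poly (pderiv T) (cos t) - sin t ^ 2 * poly (pderiv (pderiv T)) (cos t)
      = real n ^ 2 * cos (real n * t)" for t
  proof -
    have "((\<lambda>t. sin t * poly (pderiv T) (cos t)) has_real_derivative
        cos t * poly (pderiv T) (cos t) - sin t ^ 2 * poly (pderiv (pderiv T)) (cos t)) (at t)"
      by (auto intro!: derivative_eq_intros simp: power2_eq_square)
    moreover have "((\<lambda>t. sin t * poly (pderiv T) (cos t)) has_real_derivative
        real n ^ 2 * cos (real n * t)) (at t)"
      unfolding T_def sin_mult_pderiv_cheb by (auto intro!: derivative_eq_intros simp: power2_eq_square)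
    ultimately show ?thesis using DERIV_unique by blast
  qed
  have "poly ?L x = 0" if "x \<in> {-1..1}" for x
  proof -
    have x: "x = cos (arccos x)" using that by simp
    have "1 - x\<^sup>2 = sin (arccos x) ^ 2" by (subst x) (simp add: sin_squared_eq)
    moreover have "poly T x = cos (real n * arccos x)"
      by (subst x) (simp add: T_def poly_cheb_cos del: cos_arccos)
    moreover have "poly ?L x = (1 - x\<^sup>2) * poly (pderiv (pderiv T)) x - x * poly (pderiv T) x
        + real n ^ 2 * poly T x"
      by (simp add: T_def power2_eq_square algebra_simps)
    ultimately show ?thesis
      using 2[of "arccos x"] that by simp
  qed
  then have "{-1..1} \<subseteq> {x. poly ?L x = 0}" by blast
  then have "finite {-1..1::real}"
    using poly_roots_finite[OF nz] finite_subset by blast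
  then show False by (simp add: infinite_Icc)
qed

lemma poly_cheb_ode:
  "(1 - x\<^sup>2) * poly (pderiv (pderiv (cheb n))) x - x * poly (pderiv (cheb n)) x
     + real n ^ 2 * poly (cheb n) x = 0"
  using arg_cong[OF cheb_ode[of n], of "\<lambda>p. poly p x"]
  by (simp add: power2_eq_square algebra_simps)

section \<open>Roots and extremal points of the Chebyshev polynomials\<close>

definition cheb_roots :: "nat \<Rightarrow> real set" where
  "cheb_roots n = (\<lambda>i. cos ((2 * real i + 1) * pi / (2 * real n))) ` {..<n}"

text \<open>For \<open>n >= 1\<close> these are the points of \<open>[-1, 1]\<close> where the
  Chebyshev polynomial is 1 or -1, both endpoints included.\<close>

definition cheb_nodes :: "nat \<Rightarrow> real set" where
  "cheb_nodes n = (\<lambda>i. cos (real i * pi / real n)) ` {..n}"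

lemma finite_cheb_roots [simp]: "finite (cheb_roots n)"
  by (simp add: cheb_roots_def)

lemma finite_cheb_nodes [simp]: "finite (cheb_nodes n)"
  by (simp add: cheb_nodes_def)

lemma card_cheb_roots [simp]: "card (cheb_roots n) = n"
proof -
  have "inj_on (\<lambda>i. cos ((2 * real i + 1) * pi / (2 * real n))) {..<n}"
  proof (rule inj_onI)
    fix i j assume ij: "i \<in> {..<n}" "j \<in> {..<n}"
      and eq: "cos ((2 * real i + 1) * pi / (2 * real n)) = cos ((2 * real j + 1) * pi / (2 * real n))"
    have "(2 * real m + 1) * pi / (2 * real n) \<in> {0..pi}" if "m \<in> {..<n}" for m
    proof -
      have "(2 * real m + 1) / (2 * real n) \<in> {0..1}" using that by auto
      then have "0 * pi \<le> (2 * real m + 1) / (2 * real n) * pi"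
          "(2 * real m + 1) / (2 * real n) * pi \<le> 1 * pi"
        by (intro mult_right_mono; simp)+
      then show ?thesis by simp
    qed
    from this[OF ij(1)] this[OF ij(2)]
    have "(2 * real i + 1) * pi / (2 * real n) = (2 * real j + 1) * pi / (2 * real n)"
      unfolding atLeastAtMost_iff by (intro cos_inj_pi[OF _ _ _ _ eq]) blast+
    then show "i = j" using ij by auto
  qed
  then show ?thesis by (simp add: cheb_roots_def card_image)
qed

lemma card_cheb_nodes:
  assumes "n \<ge> 1" shows "card (cheb_nodes n) = Suc n"
proof -
  have "inj_on (\<lambda>i. cos (real i * pi / real n)) {..n}"
  proof (rule inj_onI)
    fix i j assume ij: "i \<in> {..n}" "j \<in> {..n}"
      and eq: "cos (real i * pi / real n) = cos (real j * pi / real n)"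
    have "real m * pi / real n \<in> {0..pi}" if "m \<in> {..n}" for m
      using that assms by (auto simp: field_simps)
    from this[OF ij(1)] this[OF ij(2)]
    have "real i * pi / real n = real j * pi / real n"
      unfolding atLeastAtMost_iff by (intro cos_inj_pi[OF _ _ _ _ eq]) blast+
    then show "i = j" using assms by auto
  qed
  then show ?thesis by (simp add: cheb_nodes_def card_image)
qed

lemma poly_cheb_root:
  assumes "x \<in> cheb_roots n"
  shows "poly (cheb n) x = 0" "\<bar>x\<bar> < 1"
proof -
  obtain i where i: "i < n" "x = cos ((2 * real i + 1) * pi / (2 * real n))"
    using assms by (auto simp: cheb_roots_def)
  have "real n * ((2 * real i + 1) * pi / (2 * real n)) = of_int (2 * int i + 1) * (pi / 2)"
    using i(1) by simp
  moreover have "odd (2 * int i + 1)" by simp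
  ultimately show "poly (cheb n) x = 0"
    unfolding i(2) poly_cheb_cos cos_zero_iff_int by blast
  have "0 < (2 * real i + 1) * pi / (2 * real n)" "(2 * real i + 1) * pi / (2 * real n) < pi"
    using i(1) by (simp_all add: pos_divide_less_eq mult.commute[of _ pi])
  then show "\<bar>x\<bar> < 1"
    using cos_monotone_0_pi[of 0 "(2 * real i + 1) * pi / (2 * real n)"]
      cos_monotone_0_pi[of "(2 * real i + 1) * pi / (2 * real n)" pi] i(2) by auto
qed

lemma cheb_eq_prod_roots:
  "cheb n = smult (2 ^ (n - 1)) (\<Prod>s\<in>cheb_roots n. [:-s, 1:])"
  using poly_eq_smult_prod_roots[of "cheb_roots n" "cheb n"] poly_cheb_root(1)
  by (simp add: coeff_cheb)

section \<open>The modulus of Chebyshev polynomials on vertical lines\<close>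

text \<open>The dominating series necessarily has nonnegative coefficients; a series dominates
  itself exactly when its coefficients are nonnegative.\<close>

definition fps_dom :: "real fps \<Rightarrow> real fps \<Rightarrow> bool" (infix "\<preceq>\<^sub>F" 50) where
  "f \<preceq>\<^sub>F g \<longleftrightarrow> (\<forall>n. \<bar>fps_nth f n\<bar> \<le> fps_nth g n)"

lemma fps_dom_add: "f \<preceq>\<^sub>F f' \<Longrightarrow> g \<preceq>\<^sub>F g' \<Longrightarrow> f + g \<preceq>\<^sub>F f' + g'"
  by (simp add: fps_dom_def) (meson abs_triangle_ineq add_mono order_trans)

lemma fps_dom_mult:
  assumes "f \<preceq>\<^sub>F f'" "g \<preceq>\<^sub>F g'" shows "f * g \<preceq>\<^sub>F f' * g'"
proof -
  have "\<bar>fps_nth (f * g) n\<bar> \<le> fps_nth (f' * g') n" for n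
    unfolding fps_mult_nth
    by (intro order_trans[OF sum_abs] sum_mono)
       (use assms in \<open>auto simp: fps_dom_def abs_mult intro!: mult_mono order_trans[OF abs_ge_zero]\<close>)
  then show ?thesis by (simp add: fps_dom_def)
qed

lemma fps_dom_deriv: "f \<preceq>\<^sub>F g \<Longrightarrow> fps_deriv f \<preceq>\<^sub>F fps_deriv g"
  by (auto simp: fps_dom_def abs_mult intro!: mult_left_mono)

lemma fps_dom_inverse_one_minus:
  assumes "v \<preceq>\<^sub>F w" "fps_nth v 0 = 0" "fps_nth w 0 = 0"
  shows "inverse (1 - v) \<preceq>\<^sub>F inverse (1 - w)"
proof -
  \<comment> \<open>Since \<open>u\<close> has no constant term,
    \<open>1 / (1 - u) = 1 + u / (1 - u)\<close> expresses coefficient \<open>n\<close> through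
    earlier ones.\<close>
  have rec: "fps_nth (inverse (1 - u)) n =
      (if n = 0 then 1 else 0) + (\<Sum>i=1..n. fps_nth u i * fps_nth (inverse (1 - u)) (n - i))"
    if "fps_nth u 0 = 0" for u :: "real fps" and n
  proof -
    have "inverse (1 - u) * (1 - u) = 1"
      using that by (intro inverse_mult_eq_1) simp
    then have "inverse (1 - u) = 1 + u * inverse (1 - u)"
      by (simp add: algebra_simps)
    then have "fps_nth (inverse (1 - u)) n =
        fps_nth 1 n + (\<Sum>i=0..n. fps_nth u i * fps_nth (inverse (1 - u)) (n - i))"
      by (metis fps_add_nth fps_mult_nth)
    then show ?thesis
      using that by (simp add: sum.atLeast_Suc_atMost)
  qed
  have "\<bar>fps_nth (inverse (1 - v)) n\<bar> \<le> fps_nth (inverse (1 - w)) n" for n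
  proof (induction n rule: less_induct)
    case (less n)
    have "\<bar>\<Sum>i=1..n. fps_nth v i * fps_nth (inverse (1 - v)) (n - i)\<bar>
        \<le> (\<Sum>i=1..n. fps_nth w i * fps_nth (inverse (1 - w)) (n - i))"
      by (intro order_trans[OF sum_abs] sum_mono)
         (use less assms(1) in \<open>auto simp: fps_dom_def abs_mult intro!: mult_mono order_trans[OF abs_ge_zero]\<close>)
    then show ?case
      using rec[OF assms(2), of n] rec[OF assms(3), of n] by (auto simp: abs_le_iff)
  qed
  then show ?thesis by (simp add: fps_dom_def)
qed

definition cheb_den :: "real \<Rightarrow> real fps" where
  "cheb_den t = 1 - 2 * fps_const t * fps_X + fps_X\<^sup>2"

definition cheb_gen :: "real \<Rightarrow> real fps" where
  "cheb_gen t = Abs_fps (\<lambda>n. poly (cheb n) t)"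

text \<open>The three-term recurrence, read coefficientwise.\<close>

lemma cheb_gen_den: "cheb_gen t * cheb_den t = 1 - fps_const t * fps_X"
proof (rule fps_ext)
  fix n
  have "cheb_gen t * cheb_den t = cheb_gen t - fps_const (2 * t) * (fps_X * cheb_gen t)
      + fps_X * (fps_X * cheb_gen t)"
    by (simp add: cheb_den_def algebra_simps power2_eq_square numeral_fps_const)
  then show "fps_nth (cheb_gen t * cheb_den t) n = fps_nth (1 - fps_const t * fps_X) n"
    by (cases n rule: cheb.cases) (auto simp: cheb_gen_def)
qed

text \<open>Sums of generating functions thereby become logarithmic derivatives of products of
  denominators.\<close>

lemma cheb_gen_logderiv:
  "(2 * cheb_gen t - 2) * cheb_den t = - fps_X * fps_deriv (cheb_den t)"
proof -
  have "(2 * cheb_gen t - 2) * cheb_den t = 2 * (1 - fps_const t * fps_X) - 2 * cheb_den t"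
    unfolding cheb_gen_den[symmetric] by (simp add: algebra_simps)
  also have "\<dots> = - fps_X * fps_deriv (cheb_den t)"
    by (simp add: cheb_den_def algebra_simps power2_eq_square)
  finally show ?thesis .
qed

lemma abs_cheb_le_1:
  assumes "\<bar>x\<bar> \<le> 1" shows "\<bar>poly (cheb n) x\<bar> \<le> (1::real)"
proof -
  have "x = cos (arccos x)" using assms by (simp add: abs_le_iff)
  then show ?thesis by (metis abs_cos_le_one poly_cheb_cos)
qed

lemma poly_cheb_1 [simp]: "poly (cheb n) 1 = 1"
  by (induction n rule: cheb.induct) auto

text \<open>
  Write \<open>D\<^sub>t\<close> for \<^const>\<open>cheb_den\<close> \<open>t\<close> and \<open>X\<close> for \<^const>\<open>fps_X\<close>. If \<open>z = a + \<i>y = cos (u + \<i>v)\<close>,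
  then \<open>2 |T\<^sub>n z|\<^sup>2 = T\<^sub>n A + T\<^sub>n B\<close> with \<open>A = cos 2u\<close>, \<open>B = cosh 2v\<close>, and with \<open>c = 2a\<^sup>2 - 1\<close>, \<open>Y = y\<^sup>2\<close>
  \<open>D\<^sub>A D\<^sub>B = (1 - X)\<^sup>2 D\<^sub>c - 4YX(1 + X)\<^sup>2 = (1 - X)\<^sup>2 D\<^sub>c (1 - V)\<close>. The series \<open>Q\<close> is \<open>-X\<close> times the
  logarithmic derivative of this product. The factor \<open>1 / D\<^sub>c\<close> of \<open>V\<close> is written as
  \<open>(2 \<Sum>T\<^sub>n(c) X\<^sup>n - 1) / (1 - X\<^sup>2)\<close>, so that \<open>c\<close> enters only through \<open>T\<^sub>n(c)\<close>, which is largest in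
  modulus at \<open>c = 1\<close>.
\<close>
definition cheb_V :: "real \<Rightarrow> real \<Rightarrow> real fps" where
  "cheb_V c Y = fps_const (4 * Y) * fps_X * (1 + fps_X)\<^sup>2 *
     ((inverse (1 - fps_X))\<^sup>2 * ((2 * cheb_gen c - 1) * inverse (1 - fps_X\<^sup>2)))"

definition cheb_Q :: "real \<Rightarrow> real \<Rightarrow> real fps" where
  "cheb_Q c Y = 2 * fps_X * inverse (1 - fps_X) + (2 * cheb_gen c - 2)
     + fps_X * fps_deriv (cheb_V c Y) * inverse (1 - cheb_V c Y)"

lemma fps_dom_refl: "(\<And>n. fps_nth f n \<ge> 0) \<Longrightarrow> f \<preceq>\<^sub>F f"
  by (simp add: fps_dom_def)

lemma cheb_V_nth_0 [simp]: "fps_nth (cheb_V c Y) 0 = 0"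
  by (simp add: cheb_V_def)

lemma cheb_Q_dom:
  assumes "\<bar>c\<bar> \<le> 1" "Y \<ge> 0"
  shows "cheb_Q c Y \<preceq>\<^sub>F cheb_Q 1 Y"
proof -
  have X: "fps_X \<preceq>\<^sub>F fps_X" "fps_X\<^sup>2 \<preceq>\<^sub>F fps_X\<^sup>2"
    by (auto intro!: fps_dom_refl simp: fps_X_power_nth)
  have I: "inverse (1 - fps_X) \<preceq>\<^sub>F inverse (1 - fps_X)"
    "inverse (1 - fps_X\<^sup>2) \<preceq>\<^sub>F inverse (1 - fps_X\<^sup>2)"
    using X by (auto intro!: fps_dom_inverse_one_minus)
  \<comment> \<open>The subtracted constants change only coefficient 0, which becomes 1 or 0
    whatever \<open>c\<close> is.\<close>
  have G: "2 * cheb_gen c - 1 \<preceq>\<^sub>F 2 * cheb_gen 1 - 1" "2 * cheb_gen c - 2 \<preceq>\<^sub>F 2 * cheb_gen 1 - 2"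
    using abs_cheb_le_1[OF assms(1)]
    by (auto simp: fps_dom_def cheb_gen_def numeral_fps_const abs_mult)
  have C: "fps_const (4 * Y) \<preceq>\<^sub>F fps_const (4 * Y)" "1 + fps_X \<preceq>\<^sub>F 1 + fps_X" "2 \<preceq>\<^sub>F 2"
    using assms by (auto intro!: fps_dom_refl simp: numeral_fps_const)
  have V: "cheb_V c Y \<preceq>\<^sub>F cheb_V 1 Y"
    unfolding cheb_V_def power2_eq_square[of "1 + fps_X"] power2_eq_square[of "inverse _"]
    by (intro fps_dom_mult X I G C)
  show ?thesis
    unfolding cheb_Q_def
    by (intro fps_dom_add fps_dom_mult fps_dom_deriv fps_dom_inverse_one_minus X I G C V) auto
qed

text \<open>Multiplied by the product \<open>P\<close> of the two denominators, both sides equal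
  \<open>- X P'\<close>, and \<open>P\<close> cancels. Here \<open>a\<close> stands for the square
  of the real part.\<close>

lemma cheb_gen_sum:
  assumes sum: "A + B = 2 * (a + Y)" and prod: "A * B = 2 * a - 2 * Y - 1"
  shows "2 * cheb_gen A + 2 * cheb_gen B - 4 = cheb_Q (2 * a - 1) Y"
proof -
  define c where "c = 2 * a - 1"
  define U where "U = (1 - fps_X)\<^sup>2 * cheb_den c"
  define V where "V = cheb_V c Y"
  define P where "P = cheb_den A * cheb_den B"
  define I where "I = inverse (1 - fps_X :: real fps)"
  define J where "J = inverse (1 - fps_X\<^sup>2 :: real fps)"
  define R where "R = inverse (1 - V)"
  have I: "I * (1 - fps_X) = 1" unfolding I_def by (intro inverse_mult_eq_1) simp
  have J: "J * (1 - fps_X\<^sup>2) = 1" unfolding J_def by (intro inverse_mult_eq_1) simp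
  have R: "R * (1 - V) = 1" unfolding R_def V_def by (intro inverse_mult_eq_1) simp
  \<comment> \<open>This makes the last factor of \<open>cheb_V\<close> equal to
    \<open>1 / cheb_den c\<close>, so that \<open>V * U\<close> is a polynomial.\<close>
  have den: "(2 * cheb_gen c - 1) * cheb_den c = 1 - fps_X\<^sup>2"
    using cheb_gen_den[of c] unfolding cheb_den_def by algebra
  have VU: "V * U = fps_const (4 * Y) * fps_X * (1 + fps_X)\<^sup>2"
  proof -
    have "V * U = fps_const (4 * Y) * fps_X * (1 + fps_X)\<^sup>2 *
        ((I * (1 - fps_X))\<^sup>2 * (J * ((2 * cheb_gen c - 1) * cheb_den c)))"
      unfolding V_def U_def cheb_V_def I_def J_def by (simp only: power_mult_distrib mult_ac)
    then show ?thesis by (simp add: I J den)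
  qed
  have P: "P = U * (1 - V)"
  proof -
    define kA kB ka kY where k: "kA = fps_const A" "kB = fps_const B" "ka = fps_const a" "kY = fps_const Y"
    have "kA + kB = 2 * (ka + kY)" "kA * kB = 2 * ka - 2 * kY - 1"
      using sum prod by (simp_all add: k numeral_fps_const flip: fps_const_1_eq_1)
    moreover have "fps_const c = 2 * ka - 1" "fps_const (4 * Y) = 4 * kY"
      by (simp_all add: k c_def numeral_fps_const flip: fps_const_1_eq_1)
    ultimately have "cheb_den A * cheb_den B = (1 - fps_X)\<^sup>2 * cheb_den c
        - fps_const (4 * Y) * fps_X * (1 + fps_X)\<^sup>2"
      unfolding cheb_den_def k[symmetric] by algebra
    then show ?thesis
      unfolding P_def VU[symmetric] U_def[symmetric] by (simp add: algebra_simps)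
  qed
  have P0: "P \<noteq> 0"
  proof -
    have "fps_nth P 0 = 1" by (simp add: P_def cheb_den_def)
    then show ?thesis by auto
  qed
  have "(2 * cheb_gen A + 2 * cheb_gen B - 4) * P =
      (2 * cheb_gen A - 2) * cheb_den A * cheb_den B + (2 * cheb_gen B - 2) * cheb_den B * cheb_den A"
    by (simp add: P_def algebra_simps)
  also have "\<dots> = - fps_X * fps_deriv P"
    unfolding cheb_gen_logderiv by (simp add: P_def algebra_simps)
  \<comment> \<open>With \<open>P = U (1 - V)\<close>, the quotient \<open>- X P' / P\<close> is
    \<open>- X U' / U + X V' / (1 - V)\<close>, which is the shape of \<open>cheb_Q\<close>.\<close>
  also have "\<dots> = cheb_Q c Y * P"
  proof -
    have dU: "(2 * fps_X * I + (2 * cheb_gen c - 2)) * U = - fps_X * fps_deriv U"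
    proof -
      have "(2 * fps_X * I + (2 * cheb_gen c - 2)) * U =
          2 * fps_X * (I * (1 - fps_X)) * (1 - fps_X) * cheb_den c
          + (1 - fps_X)\<^sup>2 * ((2 * cheb_gen c - 2) * cheb_den c)"
        by (simp add: U_def algebra_simps power2_eq_square)
      also have "\<dots> = - fps_X * fps_deriv U"
        unfolding I cheb_gen_logderiv by (simp add: U_def power2_eq_square algebra_simps)
      finally show ?thesis .
    qed
    have "cheb_Q c Y * P = (2 * fps_X * I + (2 * cheb_gen c - 2)) * U * (1 - V)
        + fps_X * fps_deriv V * U * (R * (1 - V))"
      unfolding P cheb_Q_def V_def[symmetric] I_def[symmetric] R_def[symmetric]
      by (simp only: distrib_left distrib_right mult_ac add_ac)
    also have "\<dots> = - fps_X * fps_deriv P"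
    proof -
      have "fps_deriv P = fps_deriv U * (1 - V) - U * fps_deriv V"
        unfolding P by simp
      then show ?thesis unfolding dU R by algebra
    qed
    finally show ?thesis ..
  qed
  finally show ?thesis
    unfolding mult_right_cancel[OF P0] c_def .
qed

lemma poly_cheb_cosh: "poly (cheb n) (cosh v) = cosh (real n * v)" for v :: real
proof (induction n rule: cheb.induct)
  case (3 n)
  have "cosh (real (Suc (Suc n)) * v) + cosh (real n * v) =
      cosh (real (Suc n) * v + v) + cosh (real (Suc n) * v - v)"
    by (simp add: algebra_simps)
  also have "\<dots> = 2 * cosh v * cosh (real (Suc n) * v)"
    unfolding cosh_add cosh_diff by (simp add: algebra_simps)
  finally show ?case
    using 3 by (simp add: algebra_simps)
qed simp_all

lemma norm_cheb_squared:
  assumes "n \<ge> 1"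
  shows "4 * (norm (poly (cheb n) (Complex a y)))\<^sup>2 = fps_nth (cheb_Q (2 * a\<^sup>2 - 1) (y\<^sup>2)) n"
proof -
  define w where "w = Arccos (Complex a y)"
  define u v where "u = Re w" and "v = Im w"
  have z: "Complex a y = cos w" by (simp add: w_def)
  have "cos w = Complex (cos u * cosh v) (- sin u * sinh v)"
    by (simp add: complex_eq_iff Re_cos Im_cos u_def v_def cosh_field_def sinh_field_def algebra_simps)
  then have ay: "a = cos u * cosh v" "y = - sin u * sinh v"
    using z by simp_all
  have sq: "2 * (norm (cos (of_nat m * w)))\<^sup>2 = cos (2 * (real m * u)) + cosh (2 * (real m * v))" for m
  proof -
    have "(exp t - inverse (exp t))\<^sup>2 / 4 = (sinh t)\<^sup>2" for t :: real
      by (simp add: sinh_field_def exp_minus power_divide)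
    then show ?thesis
      unfolding norm_cos_squared cos_double_cos cosh_double_cosh
      by (simp add: u_def v_def sinh_square_eq)
  qed
  have "2 * (norm (poly (cheb n) (Complex a y)))\<^sup>2 = cos (real n * (2 * u)) + cosh (real n * (2 * v))"
    unfolding z poly_cheb_cos sq by (simp add: algebra_simps)
  also have "\<dots> = poly (cheb n) (cos (2 * u)) + poly (cheb n) (cosh (2 * v))"
    by (simp add: poly_cheb_cos poly_cheb_cosh)
  \<comment> \<open>Here \<open>n >= 1\<close> enters: the subtracted 4 affects only coefficient
    0.\<close>
  finally have "4 * (norm (poly (cheb n) (Complex a y)))\<^sup>2 =
      fps_nth (2 * cheb_gen (cos (2 * u)) + 2 * cheb_gen (cosh (2 * v)) - 4) n"
    using assms by (simp add: cheb_gen_def numeral_fps_const)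
  also have "2 * cheb_gen (cos (2 * u)) + 2 * cheb_gen (cosh (2 * v)) - 4 = cheb_Q (2 * a\<^sup>2 - 1) (y\<^sup>2)"
  proof (rule cheb_gen_sum)
    define C H where "C = (cos u)\<^sup>2" and "H = (cosh v)\<^sup>2"
    have 1: "cos (2 * u) = 2 * C - 1" "cosh (2 * v) = 2 * H - 1"
      by (simp_all add: C_def H_def cos_double_cos cosh_double_cosh)
    have 2: "a\<^sup>2 = C * H" "y\<^sup>2 = (1 - C) * (H - 1)"
      unfolding ay by (simp_all add: C_def H_def power_mult_distrib sin_squared_eq sinh_square_eq)
    show "cos (2 * u) + cosh (2 * v) = 2 * (a\<^sup>2 + y\<^sup>2)"
      "cos (2 * u) * cosh (2 * v) = 2 * a\<^sup>2 - 2 * y\<^sup>2 - 1"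
      unfolding 1 2 by (simp_all add: algebra_simps)
  qed
  finally show ?thesis .
qed

text \<open>The parameter \<open>2 * a^2 - 1\<close> lies in \<open>[-1, 1]\<close> and equals 1 for
  \<open>a = 1\<close>, the dominating case.\<close>

lemma norm_cheb_le:
  assumes "\<bar>a\<bar> \<le> 1"
  shows "norm (poly (cheb n) (Complex a y)) \<le> norm (poly (cheb n) (Complex 1 y))"
proof (cases "n = 0")
  case False
  have "a\<^sup>2 \<le> 1" using assms by (simp add: abs_square_le_1)
  then have "cheb_Q (2 * a\<^sup>2 - 1) (y\<^sup>2) \<preceq>\<^sub>F cheb_Q 1 (y\<^sup>2)"
    by (intro cheb_Q_dom) (auto simp: abs_le_iff)
  then have "4 * (norm (poly (cheb n) (Complex a y)))\<^sup>2 \<le> 4 * (norm (poly (cheb n) (Complex 1 y)))\<^sup>2"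
    using norm_cheb_squared[of n a y] norm_cheb_squared[of n 1 y] False
    by (auto simp: fps_dom_def abs_le_iff)
  then show ?thesis by (intro power2_le_imp_le[OF _ norm_ge_zero]) linarith
qed simp

section \<open>The derivative at the Chebyshev roots\<close>

lemma poly_cheb_node:
  assumes "x \<in> cheb_nodes n" "n \<ge> 1"
  shows "\<bar>x\<bar> \<le> 1" "\<bar>poly (cheb n) x\<bar> = 1" "(x\<^sup>2 - 1) * poly (pderiv (cheb n)) x = 0"
proof -
  obtain i where i: "x = cos (real i * pi / real n)"
    using assms by (auto simp: cheb_nodes_def)
  have ni: "real n * (real i * pi / real n) = real i * pi" using assms by simp
  show "\<bar>x\<bar> \<le> 1" by (simp add: i)
  show "\<bar>poly (cheb n) x\<bar> = 1"
    unfolding i poly_cheb_cos ni by (simp add: cos_npi)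
  have "sin (real i * pi / real n) * poly (pderiv (cheb n)) x = 0"
    unfolding i sin_mult_pderiv_cheb ni by (simp add: sin_npi)
  then show "(x\<^sup>2 - 1) * poly (pderiv (cheb n)) x = 0"
    using sin_squared_eq[of "real i * pi / real n"] by (auto simp: i)
qed

text \<open>
  Interpolate at the zeros of \<open>W = (x\<^sup>2 - 1) T\<^sub>n'\<close>. By the differential equation, at a root \<open>\<xi>\<close> of \<open>T\<^sub>n\<close> the
  derivatives of the Lagrange basis polynomials are \<open>T\<^sub>n'(\<xi>) (1 - \<xi>s) / (W'(s) (\<xi> - s)\<^sup>2)\<close>, whose signs
  are those of \<open>T\<^sub>n(s)\<close> up to a common factor.
\<close>
lemma bernstein_at_cheb_roots:
  fixes p :: "real poly"
  assumes n: "n \<ge> 1" and deg: "degree p \<le> n"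
    and bd: "\<And>x. \<bar>x\<bar> \<le> 1 \<Longrightarrow> \<bar>poly p x\<bar> \<le> 1"
    and xi: "\<xi> \<in> cheb_roots n"
  shows "\<bar>poly (pderiv p) \<xi>\<bar> \<le> \<bar>poly (pderiv (cheb n)) \<xi>\<bar>"
proof -
  define T where "T = (cheb n :: real poly)"
  define S where "S = cheb_nodes n"
  define W where "W = [:-1, 0, 1:] * pderiv T"
  define \<omega> where "\<omega> = (\<lambda>s. \<Prod>t\<in>S-{s}. [:-t, 1:])"
  have S: "finite S" "card S = Suc n" using n by (auto simp: S_def card_cheb_nodes)
  have Tp: "pderiv T \<noteq> 0" using n by (simp add: pderiv_eq_0_iff T_def)
  have degW: "degree W = card S"
    unfolding W_def S using Tp n by (subst degree_mult_eq) (auto simp: degree_pderiv T_def)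
  define l where "l = lead_coeff W"
  have "W \<noteq> 0" using degW S by auto
  then have l: "l \<noteq> 0" by (simp add: l_def)
  have W: "W = smult l (\<Prod>s\<in>S. [:-s, 1:])"
    unfolding l_def
  proof (rule poly_eq_smult_prod_roots[OF S(1) degW])
    fix s assume "s \<in> S"
    then show "poly W s = 0"
      using poly_cheb_node(3)[of s n] n by (simp add: W_def S_def T_def power2_eq_square algebra_simps)
  qed
  have W': "poly (pderiv W) x = real n ^ 2 * poly T x + x * poly (pderiv T) x" for x
  proof -
    have "poly (pderiv W) x = 2 * x * poly (pderiv T) x + (x\<^sup>2 - 1) * poly (pderiv (pderiv T)) x"
      unfolding W_def pderiv_mult by (simp add: pderiv_pCons power2_eq_square algebra_simps)
    moreover have "(1 - x\<^sup>2) * poly (pderiv (pderiv T)) x - x * poly (pderiv T) x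
        + real n ^ 2 * poly T x = 0"
      unfolding T_def by (rule poly_cheb_ode)
    ultimately show ?thesis by (simp add: algebra_simps)
  qed
  have Ws: "W = smult l ([:-s, 1:] * \<omega> s)" if "s \<in> S" for s
    unfolding W \<omega>_def using S(1) that by (simp only: prod.remove)
  have W's: "poly (pderiv W) x = l * (poly (\<omega> s) x + (x - s) * poly (pderiv (\<omega> s)) x)" if "s \<in> S" for s x
    unfolding Ws[OF that] pderiv_smult pderiv_mult
    by (simp add: pderiv_pCons left_diff_distrib)
  \<comment> \<open>If \<open>s^2 = 1\<close>, the differential equation gives
    \<open>s T'(s) = n^2 T(s)\<close>; otherwise \<open>T'(s) = 0\<close>. So the product is
    \<open>2 n^2\<close> or \<open>n^2\<close>.\<close>
  have sign: "poly T s * poly (pderiv W) s > 0" if "s \<in> S" for s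
  proof -
    have T2: "(poly T s)\<^sup>2 = 1"
      using poly_cheb_node(2)[of s n] that n by (simp add: S_def T_def abs_square_eq_1)
    have "s * poly (pderiv T) s = 0 \<or> s * poly (pderiv T) s = real n ^ 2 * poly T s"
    proof (cases "s\<^sup>2 = 1")
      case True
      then show ?thesis
        using poly_cheb_ode[of s n] by (simp add: T_def)
    next
      case False
      then show ?thesis
        using poly_cheb_node(3)[of s n] that n by (simp add: S_def T_def)
    qed
    then have "poly T s * poly (pderiv W) s = real n ^ 2 * (poly T s)\<^sup>2 \<or>
        poly T s * poly (pderiv W) s = 2 * real n ^ 2 * (poly T s)\<^sup>2"
      unfolding W' by (auto simp: power2_eq_square algebra_simps)
    then show ?thesis using n unfolding T2 by auto
  qed
  have T\<xi>: "poly T \<xi> = 0" "\<bar>\<xi>\<bar> < 1" using poly_cheb_root[OF xi] by (auto simp: T_def)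
  \<comment> \<open>\<open>poly (pderiv T) \<xi> * k s\<close> is the derivative at \<xi> of the
    Lagrange basis polynomial of \<open>s\<close>.\<close>
  define k where "k = (\<lambda>s. (1 - \<xi> * s) / (poly (pderiv W) s * (\<xi> - s)\<^sup>2))"
  have interp: "poly (pderiv q) \<xi> = poly (pderiv T) \<xi> * (\<Sum>s\<in>S. poly q s * k s)" if q: "degree q \<le> n" for q
  proof -
    have "q = (\<Sum>s\<in>S. smult (poly q s / (\<Prod>t\<in>S-{s}. s - t)) (\<omega> s))"
      unfolding \<omega>_def by (rule lagrange_interpolation) (use S q in auto)
    then have "poly (pderiv q) \<xi> = (\<Sum>s\<in>S. poly q s / (\<Prod>t\<in>S-{s}. s - t) * poly (pderiv (\<omega> s)) \<xi>)"
      by (metis (no_types, lifting) pderiv_smult pderiv_sum poly_smult poly_sum sum.cong)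
    also have "\<dots> = (\<Sum>s\<in>S. poly (pderiv T) \<xi> * (poly q s * k s))"
    proof (rule sum.cong[OF refl])
      fix s assume s: "s \<in> S"
      have ne: "\<xi> \<noteq> s" using sign[OF s] T\<xi> by auto
      have 1: "poly (pderiv W) s = l * (\<Prod>t\<in>S-{s}. s - t)"
        by (simp add: W's[OF s] \<omega>_def poly_prod)
      then have ne': "(\<Prod>t\<in>S-{s}. s - t) \<noteq> 0" using sign[OF s] by auto
      \<comment> \<open>Eliminating \<open>poly (\<omega> s) \<xi>\<close> between \<open>W\<close>
        and \<open>W'\<close> isolates the derivative of \<open>\<omega> s\<close>.\<close>
      have "poly W \<xi> = l * ((\<xi> - s) * poly (\<omega> s) \<xi>)"
        by (simp add: Ws[OF s] left_diff_distrib)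
      then have "l * ((\<xi> - s)\<^sup>2 * poly (pderiv (\<omega> s)) \<xi>) = (\<xi> - s) * poly (pderiv W) \<xi> - poly W \<xi>"
        unfolding W's[OF s] by (simp add: power2_eq_square algebra_simps)
      also have "\<dots> = poly (pderiv T) \<xi> * (1 - \<xi> * s)"
        unfolding W' T\<xi>(1) by (simp add: W_def algebra_simps)
      finally have "poly (pderiv (\<omega> s)) \<xi> = poly (pderiv T) \<xi> * (1 - \<xi> * s) / (l * (\<xi> - s)\<^sup>2)"
        using l ne by (simp add: field_simps)
      then show "poly q s / (\<Prod>t\<in>S-{s}. s - t) * poly (pderiv (\<omega> s)) \<xi> =
          poly (pderiv T) \<xi> * (poly q s * k s)"
        using l ne ne' by (simp add: k_def 1 mult_ac)
    qed
    finally show ?thesis by (simp add: sum_distrib_left)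
  qed
  show ?thesis
  proof (cases "poly (pderiv T) \<xi> = 0")
    case True
    then show ?thesis using interp[OF deg] by simp
  next
    case False
    have kpos: "poly T s * k s = \<bar>k s\<bar>" if s: "s \<in> S" for s
    proof -
      have "\<bar>\<xi> * s\<bar> \<le> 1 * 1"
        unfolding abs_mult using T\<xi>(2) poly_cheb_node(1)[of s n] s n
        by (intro mult_mono) (auto simp: S_def)
      then have "1 - \<xi> * s \<ge> 0" by linarith
      have "\<bar>poly T s\<bar> = 1" using poly_cheb_node(2)[of s n] s n by (simp add: S_def T_def)
      then consider "poly T s = 1" | "poly T s = -1" by linarith
      then show ?thesis
      proof cases
        case 1
        then have "k s \<ge> 0"
          using sign[OF s] \<open>1 - \<xi> * s \<ge> 0\<close> by (simp add: k_def)
        then show ?thesis using 1 by simp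
      next
        case 2
        then have "k s \<le> 0"
          using sign[OF s] \<open>1 - \<xi> * s \<ge> 0\<close>
          by (auto simp: k_def intro!: divide_nonneg_nonpos mult_nonpos_nonneg)
        then show ?thesis using 2 by simp
      qed
    qed
    \<comment> \<open>Interpolating \<open>T\<close> itself evaluates the sum of the absolute
      weights, because its values carry their signs.\<close>
    have "(\<Sum>s\<in>S. \<bar>k s\<bar>) = (\<Sum>s\<in>S. poly T s * k s)"
      by (intro sum.cong refl) (simp add: kpos)
    also have "\<dots> = 1"
      using interp[of T] False by (simp add: T_def)
    finally have k1: "(\<Sum>s\<in>S. \<bar>k s\<bar>) = 1" .
    have "\<bar>\<Sum>s\<in>S. poly p s * k s\<bar> \<le> (\<Sum>s\<in>S. \<bar>k s\<bar>)"
    proof (intro order_trans[OF sum_abs] sum_mono)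
      fix s assume "s \<in> S"
      then have "\<bar>poly p s\<bar> \<le> 1" using bd poly_cheb_node(1)[of s n] n by (simp add: S_def)
      then show "\<bar>poly p s * k s\<bar> \<le> \<bar>k s\<bar>"
        by (simp add: abs_mult mult_left_le_one_le)
    qed
    then have "\<bar>poly (pderiv T) \<xi>\<bar> * \<bar>\<Sum>s\<in>S. poly p s * k s\<bar> \<le> \<bar>poly (pderiv T) \<xi>\<bar> * 1"
      unfolding k1 by (intro mult_left_mono) auto
    then show ?thesis
      using interp[OF deg] by (simp add: abs_mult T_def)
  qed
qed

section \<open>Markov's inequality\<close>

lemma complexify_cheb: "complexify (cheb n) = cheb n"
  by (induction n rule: cheb.induct)
     (simp_all only: cheb.simps complexify_diff complexify_mult, simp_all add: map_poly_pCons)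

lemma cmod_le_cmod:
  assumes "\<bar>Re a\<bar> \<le> \<bar>Re b\<bar>" "\<bar>Im a\<bar> \<le> \<bar>Im b\<bar>" shows "cmod a \<le> cmod b"
  unfolding cmod_def using assms by (intro real_sqrt_le_mono add_mono) (simp_all add: abs_le_square_iff)

text \<open>The roots of the Chebyshev polynomial lie in \<open>(-1, 1)\<close>, so the shift by 1
  moves them left of the imaginary axis.\<close>

lemma cheb_shift_roots:
  assumes "poly (pcompose (cheb n) [:1, 1:]) (z :: complex) = 0"
  shows "Re z < 0"
proof -
  have "poly (cheb n :: complex poly) (1 + z) = 0"
    using assms by (simp add: poly_pcompose add.commute)
  moreover have "(cheb n :: complex poly) =
      smult (2 ^ (n - 1)) (\<Prod>s\<in>cheb_roots n. [:- of_real s, 1:])"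
    by (subst complexify_cheb[symmetric], subst cheb_eq_prod_roots)
       (simp add: complexify_smult complexify_prod map_poly_pCons)
  ultimately obtain s where s: "s \<in> cheb_roots n" "1 + z - of_real s = 0"
    by (auto simp: poly_prod)
  then have "Re (1 + z - of_real s) = 0" by (simp only: zero_complex.simps)
  then show ?thesis using poly_cheb_root(2)[OF s(1)] by simp
qed

text \<open>
  Reflecting the roots of the Chebyshev polynomial to the left of \<open>a\<close> does not change its
  modulus on the line \<open>Re z = a\<close>, but aligns all terms of the partial fraction expansion.
\<close>
lemma norm_pderiv_le_pderiv_cheb:
  fixes p :: "real poly"
  assumes n: "n \<ge> 1" and deg: "degree p \<le> n"
    and bd: "\<And>x. \<bar>x\<bar> \<le> 1 \<Longrightarrow> \<bar>poly p x\<bar> \<le> 1"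
    and a: "\<bar>a\<bar> \<le> 1" and y: "y \<noteq> 0"
  shows "norm (poly (complexify (pderiv p)) (Complex a y))
    \<le> norm (poly (pderiv (pcompose (cheb n) [:1, 1:])) (\<i> * of_real y))"
proof -
  define R where "R = cheb_roots n"
  define z where "z = Complex a y"
  define K where "K = (2 ^ (n - 1) :: real)"
  have R: "finite R" "card R = n" by (simp_all add: R_def)
  have K: "K > 0" by (simp add: K_def)
  have T: "cheb n = smult K (\<Prod>s\<in>R. [:-s, 1:])"
    unfolding R_def K_def by (rule cheb_eq_prod_roots)
  define N where "N = (\<lambda>s. \<Prod>t\<in>R-{s}. s - t)"
  have T': "poly (pderiv (cheb n)) s = K * N s" if "s \<in> R" for s
  proof -
    have "cheb n = smult K ([:-s, 1:] * (\<Prod>t\<in>R-{s}. [:-t, 1:]))"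
      unfolding T using R(1) that by (simp only: prod.remove)
    then have "pderiv (cheb n) = smult K ((\<Prod>t\<in>R-{s}. [:-t, 1:]) + [:-s, 1:] * pderiv (\<Prod>t\<in>R-{s}. [:-t, 1:]))"
      by (simp only: pderiv_smult pderiv_mult) (simp add: pderiv_pCons add.commute)
    then show ?thesis by (simp add: poly_prod N_def)
  qed
  have N: "N s \<noteq> 0" for s using R(1) by (simp add: N_def prod_zero_iff)
  \<comment> \<open>The ratio of \<open>p'\<close> to the derivative of \<open>cheb n\<close> at a
    root \<open>s\<close>.\<close>
  define \<epsilon> where "\<epsilon> = (\<lambda>s. poly (pderiv p) s / (K * N s))"
  have \<epsilon>: "\<bar>\<epsilon> s\<bar> \<le> 1" if "s \<in> R" for s
    using bernstein_at_cheb_roots[OF n deg bd, of s] that T'[OF that] N[of s] K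
    by (simp add: \<epsilon>_def R_def divide_le_eq_1)
  have zs: "z \<noteq> of_real s" for s using y by (simp add: z_def complex_eq_iff)
  have rem: "(\<Prod>t\<in>R-{s}. f t) = (\<Prod>t\<in>R. f t) / f s" if "s \<in> R" "f s \<noteq> 0" for f :: "real \<Rightarrow> complex" and s
    using R(1) that by (simp add: prod.remove[of R s])
  have "poly (complexify (pderiv p)) z = of_real K * (\<Prod>t\<in>R. z - of_real t) * (\<Sum>s\<in>R. of_real (\<epsilon> s) / (z - of_real s))"
  proof -
    have "pderiv p = (\<Sum>s\<in>R. smult (poly (pderiv p) s / N s) (\<Prod>t\<in>R-{s}. [:-t, 1:]))"
      unfolding N_def using n deg R by (intro lagrange_interpolation) (auto simp: degree_pderiv)
    then have "complexify (pderiv p) =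
        complexify (\<Sum>s\<in>R. smult (poly (pderiv p) s / N s) (\<Prod>t\<in>R-{s}. [:-t, 1:]))"
      by (rule arg_cong)
    also have "poly \<dots> z = (\<Sum>s\<in>R. of_real (poly (pderiv p) s / N s) * (\<Prod>t\<in>R-{s}. z - of_real t))"
      by (simp add: complexify_sum complexify_smult complexify_prod map_poly_pCons poly_sum poly_prod)
    also have "\<dots> = (\<Sum>s\<in>R. of_real K * (\<Prod>t\<in>R. z - of_real t) * (of_real (\<epsilon> s) / (z - of_real s)))"
      using K by (intro sum.cong refl) (simp add: rem[where f = "\<lambda>t. z - of_real t"] zs \<epsilon>_def mult_ac)
    finally show ?thesis by (simp add: sum_distrib_left)
  qed
  then have "norm (poly (complexify (pderiv p)) z) =
      norm (of_real K * (\<Prod>t\<in>R. z - of_real t)) * norm (\<Sum>s\<in>R. of_real (\<epsilon> s) / (z - of_real s))"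
    by (simp add: norm_mult)
  \<comment> \<open>After reflection all real parts are nonnegative and all imaginary parts share a
    sign, so the triangle inequality bounds both parts of the old sum by those of the new
    one.\<close>
  also have "\<dots> \<le> norm (of_real K * (\<Prod>t\<in>R. z - of_real t)) * norm (\<Sum>s\<in>R. 1 / Complex \<bar>a - s\<bar> y)"
  proof (intro mult_left_mono cmod_le_cmod)
    have den: "0 < (a - s)\<^sup>2 + y\<^sup>2" for s using y by (simp add: sum_power2_gt_zero_iff)
    have "\<bar>\<Sum>s\<in>R. \<epsilon> s * (a - s) / ((a - s)\<^sup>2 + y\<^sup>2)\<bar> \<le> (\<Sum>s\<in>R. \<bar>a - s\<bar> / ((a - s)\<^sup>2 + y\<^sup>2))"
      using \<epsilon> den by (intro order_trans[OF sum_abs] sum_mono)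
        (auto simp: abs_mult intro!: divide_right_mono mult_left_le_one_le less_imp_le[OF den])
    then show "\<bar>Re (\<Sum>s\<in>R. of_real (\<epsilon> s) / (z - of_real s))\<bar> \<le> \<bar>Re (\<Sum>s\<in>R. 1 / Complex \<bar>a - s\<bar> y)\<bar>"
      by (simp add: z_def Re_divide)
    have "\<bar>\<Sum>s\<in>R. \<epsilon> s * y / ((a - s)\<^sup>2 + y\<^sup>2)\<bar> \<le> (\<Sum>s\<in>R. \<bar>y\<bar> / ((a - s)\<^sup>2 + y\<^sup>2))"
      using \<epsilon> den by (intro order_trans[OF sum_abs] sum_mono)
        (auto simp: abs_mult intro!: divide_right_mono mult_left_le_one_le less_imp_le[OF den])
    also have "\<dots> = \<bar>\<Sum>s\<in>R. y / ((a - s)\<^sup>2 + y\<^sup>2)\<bar>"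
      using den by (cases "y > 0")
        (auto simp: abs_of_nonneg abs_of_nonpos sum_nonneg sum_nonpos less_imp_le sum_negf divide_nonpos_pos)
    finally show "\<bar>Im (\<Sum>s\<in>R. of_real (\<epsilon> s) / (z - of_real s))\<bar> \<le> \<bar>Im (\<Sum>s\<in>R. 1 / Complex \<bar>a - s\<bar> y)\<bar>"
      by (simp add: z_def Im_divide sum_negf)
  qed simp
  \<comment> \<open>The reflected sum is a logarithmic derivative, with the line
    \<open>Re z = a\<close> moved to the imaginary axis and the roots to
    \<open>- \<bar>a - s\<bar>\<close>.\<close>
  also have "\<dots> = norm (poly (pderiv (smult (of_real K) (\<Prod>s\<in>R. [:of_real \<bar>a - s\<bar>, 1:]))) (\<i> * of_real y))"
  proof -
    have C: "of_real \<bar>a - s\<bar> + \<i> * of_real y = Complex \<bar>a - s\<bar> y" for s by (simp add: complex_eq_iff)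
    have C0: "Complex \<bar>a - s\<bar> y \<noteq> 0" for s using y by (simp add: complex_eq_iff)
    have "poly (pderiv (smult (of_real K) (\<Prod>s\<in>R. [:of_real \<bar>a - s\<bar>, 1:]))) (\<i> * of_real y) =
        of_real K * (\<Sum>s\<in>R. \<Prod>t\<in>R-{s}. Complex \<bar>a - t\<bar> y)"
      by (simp add: pderiv_smult pderiv_prod poly_sum poly_prod pderiv_pCons C)
    also have "\<dots> = of_real K * (\<Prod>t\<in>R. Complex \<bar>a - t\<bar> y) * (\<Sum>s\<in>R. 1 / Complex \<bar>a - s\<bar> y)"
      by (simp add: sum_distrib_left rem[where f = "\<lambda>t. Complex \<bar>a - t\<bar> y"] C0 mult.assoc)
    finally have "norm (poly (pderiv (smult (of_real K) (\<Prod>s\<in>R. [:of_real \<bar>a - s\<bar>, 1:]))) (\<i> * of_real y)) =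
        K * (\<Prod>t\<in>R. norm (Complex \<bar>a - t\<bar> y)) * norm (\<Sum>s\<in>R. 1 / Complex \<bar>a - s\<bar> y)"
      using K by (simp add: norm_mult prod_norm)
    moreover have "norm (Complex \<bar>a - t\<bar> y) = norm (z - of_real t)" for t
      by (simp add: z_def cmod_def)
    ultimately show ?thesis
      using K by (simp add: norm_mult prod_norm)
  qed
  also have "\<dots> \<le> norm (poly (pderiv (pcompose (cheb n) [:1, 1:])) (\<i> * of_real y))"
  proof (rule norm_pderiv_le_imaginary_axis[OF cheb_shift_roots])
    show "degree (smult (of_real K) (\<Prod>s\<in>R. [:of_real \<bar>a - s\<bar>, 1:]))
        \<le> degree (pcompose (cheb n) [:1, 1:] :: complex poly)"
      using R by (auto intro!: order_trans[OF degree_smult_le] order_trans[OF degree_prod_sum_le]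
          simp: degree_pcompose)
    fix y
    have "norm (poly (smult (of_real K) (\<Prod>s\<in>R. [:of_real \<bar>a - s\<bar>, 1:])) (\<i> * of_real y)) =
        K * (\<Prod>s\<in>R. norm (of_real \<bar>a - s\<bar> + \<i> * of_real y))"
      using K by (simp add: poly_prod norm_mult prod_norm)
    also have "\<dots> = K * (\<Prod>s\<in>R. norm (Complex a y - of_real s))"
      by (simp add: cmod_def)
    also have "\<dots> = norm (poly (complexify (cheb n)) (Complex a y))"
      unfolding T using K
      by (simp add: complexify_smult complexify_prod map_poly_pCons poly_prod norm_mult prod_norm)
    also have "\<dots> \<le> norm (poly (cheb n) (Complex 1 y))"
      unfolding complexify_cheb by (rule norm_cheb_le[OF a])
    also have "Complex 1 y = 1 + \<i> * of_real y" by (simp add: complex_eq_iff)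
    finally show "norm (poly (smult (of_real K) (\<Prod>s\<in>R. [:of_real \<bar>a - s\<bar>, 1:])) (\<i> * of_real y))
        \<le> norm (poly (pcompose (cheb n) [:1, 1:]) (\<i> * of_real y))"
      by (simp add: poly_pcompose add.commute)
  qed
  finally show ?thesis by (simp add: z_def)
qed

text \<open>The first derivatives are compared on whole vertical lines; the half-plane principle,
  applied \<open>k - 1\<close> more times, gives the bound at \<open>y = 0\<close>.\<close>

lemma markov_brothers_unit:
  fixes p :: "real poly"
  assumes n: "n \<ge> 1" and deg: "degree p \<le> n" and k: "k \<ge> 1"
    and bd: "\<And>x. \<bar>x\<bar> \<le> 1 \<Longrightarrow> \<bar>poly p x\<bar> \<le> 1"
    and a: "\<bar>a\<bar> \<le> 1"
  shows "\<bar>poly ((pderiv ^^ k) p) a\<bar> \<le> \<bar>poly ((pderiv ^^ k) (cheb n)) 1\<bar>"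
proof (cases "k \<le> n")
  case False
  have "(pderiv ^^ k) p = 0"
    using False deg by (intro poly_eqI) (simp add: coeff_higher_pderiv coeff_eq_0)
  then show ?thesis by simp
next
  case True
  define f where "f = pderiv (pcompose (cheb n :: complex poly) [:1, 1:])"
  define g where "g = pcompose (complexify (pderiv p)) [:of_real a, 1:]"
  obtain j where j: "k = Suc j" using k by (cases k) auto
  have g_eval: "poly g (\<i> * of_real y) = poly (complexify (pderiv p)) (Complex a y)" for y
  proof -
    have "Complex a y = of_real a + \<i> * of_real y" by (simp add: complex_eq_iff)
    then show ?thesis by (simp add: g_def poly_pcompose add.commute)
  qed
  have degf: "degree f = n - 1" by (simp add: f_def degree_pderiv degree_pcompose)
  have le: "norm (poly g (\<i> * of_real y)) \<le> norm (poly f (\<i> * of_real y))" if "y \<noteq> 0" for y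
    unfolding g_eval f_def by (rule norm_pderiv_le_pderiv_cheb[OF n deg bd a that])
  \<comment> \<open>The partial fraction argument excludes \<open>y = 0\<close>, which is recovered
    by continuity.\<close>
  have le0: "norm (poly g (\<i> * of_real y)) \<le> norm (poly f (\<i> * of_real y))" for y
  proof (cases "y = 0")
    case True
    have lim: "((\<lambda>y. norm (poly h (\<i> * of_real y))) \<longlongrightarrow> norm (poly h (\<i> * of_real 0))) (at (0::real))" for h
      by (intro tendsto_intros)
    show ?thesis
      unfolding True by (rule tendsto_le[OF _ lim lim]) (auto simp: eventually_at_filter le)
  qed (rule le)
  have "norm (poly ((pderiv ^^ j) g) (\<i> * of_real 0)) \<le> norm (poly ((pderiv ^^ j) f) (\<i> * of_real 0))"
  proof (rule norm_higher_pderiv_le_imaginary_axis[OF _ _ le0])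
    show "Re z < 0" if "poly f z = 0" for z
      using pderiv_roots_left_half_plane[OF cheb_shift_roots _ that[unfolded f_def]] n
      by (simp add: degree_pcompose)
    show "degree g \<le> degree f" "j \<le> degree f"
      using deg True j by (auto simp: degf g_def degree_pcompose degree_pderiv)
  qed
  moreover have "poly ((pderiv ^^ j) g) 0 = of_real (poly ((pderiv ^^ k) p) a)"
    by (simp add: g_def higher_pderiv_pcompose_linear poly_pcompose j funpow_swap1 poly_complexify
        flip: complexify_higher_pderiv)
  moreover have "poly ((pderiv ^^ j) f) 0 = of_real (poly ((pderiv ^^ k) (cheb n)) 1)"
  proof -
    have "poly ((pderiv ^^ j) f) 0 = poly ((pderiv ^^ k) (pcompose (complexify (cheb n)) [:1, 1:])) 0"
      by (simp add: f_def j funpow_swap1 complexify_cheb)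
    also have "\<dots> = poly (complexify ((pderiv ^^ k) (cheb n))) (of_real 1)"
      unfolding higher_pderiv_pcompose_linear complexify_higher_pderiv by (simp add: poly_pcompose)
    finally show ?thesis unfolding poly_complexify .
  qed
  ultimately show ?thesis by simp
qed

section \<open>Derivatives of the Chebyshev polynomials at 1\<close>

lemma higher_cheb_ode:
  "[:1, 0, -1:] * (pderiv ^^ Suc (Suc k)) (cheb n) - smult (2 * real k + 1) ([:0, 1:] * (pderiv ^^ Suc k) (cheb n))
     + smult (real n ^ 2 - real k ^ 2) ((pderiv ^^ k) (cheb n)) = 0"
proof (induction k)
  case 0
  then show ?case using cheb_ode[of n] by simp
next
  case (Suc k)
  define D where "D = (\<lambda>j. (pderiv ^^ j) (cheb n :: real poly))"
  have D: "pderiv (D j) = D (Suc j)" for j by (simp add: D_def)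
  have "pderiv ([:1, 0, -1:] * D (Suc (Suc k)) - smult (2 * real k + 1) ([:0, 1:] * D (Suc k))
     + smult (real n ^ 2 - real k ^ 2) (D k)) = 0"
    using Suc by (simp only: D_def pderiv_0)
  then have "[:1, 0, -1:] * D (Suc (Suc (Suc k))) + [:0, -2:] * D (Suc (Suc k))
     - smult (2 * real k + 1) ([:0, 1:] * D (Suc (Suc k)) + D (Suc k))
     + smult (real n ^ 2 - real k ^ 2) (D (Suc k)) = 0"
    by (simp only: pderiv_add pderiv_diff pderiv_smult pderiv_mult D) (simp add: pderiv_pCons mult.commute)
  then have "poly ([:1, 0, -1:] * D (Suc (Suc (Suc k))) + [:0, -2:] * D (Suc (Suc k))
     - smult (2 * real k + 1) ([:0, 1:] * D (Suc (Suc k)) + D (Suc k))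
     + smult (real n ^ 2 - real k ^ 2) (D (Suc k))) x = 0" for x
    by (simp only: poly_0)
  \<comment> \<open>Coefficients combine by \<open>2 + (2 k + 1) = 2 (k + 1) + 1\<close> and
    \<open>k^2 + (2 k + 1) = (k + 1)^2\<close>.\<close>
  then have "poly ([:1, 0, -1:] * D (Suc (Suc (Suc k))) - smult (2 * real (Suc k) + 1) ([:0, 1:] * D (Suc (Suc k)))
     + smult (real n ^ 2 - real (Suc k) ^ 2) (D (Suc k))) x = poly 0 x" for x
    by (simp add: algebra_simps power2_eq_square)
  then show ?case
    unfolding poly_eq_poly_eq_iff[symmetric] D_def by blast
qed

lemma higher_pderiv_cheb_at_1:
  "(2 * real k + 1) * poly ((pderiv ^^ Suc k) (cheb n)) 1
     = (real n ^ 2 - real k ^ 2) * poly ((pderiv ^^ k) (cheb n)) 1"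
  using arg_cong[OF higher_cheb_ode[of k n], of "\<lambda>p. poly p 1"] by simp

lemma odd_double_fact_Suc: "odd_double_fact (Suc k) = (2 * k + 1) * odd_double_fact k"
  by (simp add: odd_double_fact_def)

lemma odd_double_fact_pos: "odd_double_fact k > 0"
  by (induction k) (simp_all add: odd_double_fact_Suc odd_double_fact_def)

text \<open>Each step of the recursion contributes a factor \<open>n^2 - k^2 <= n^2\<close>; where
  it would be negative, the derivatives already vanish.\<close>

lemma higher_pderiv_cheb_at_1_bounds:
  "0 \<le> poly ((pderiv ^^ k) (cheb n)) (1::real)"
  "real (odd_double_fact k) * poly ((pderiv ^^ k) (cheb n)) 1 \<le> real n ^ (2 * k)"
proof (induction k)
  case 0
  show "0 \<le> poly ((pderiv ^^ 0) (cheb n)) (1::real)"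
    "real (odd_double_fact 0) * poly ((pderiv ^^ 0) (cheb n)) 1 \<le> real n ^ (2 * 0)"
    by (simp_all add: odd_double_fact_def)
next
  case (Suc k)
  define a where "a = (\<lambda>j. poly ((pderiv ^^ j) (cheb n)) (1::real))"
  have zero: "a j = 0" if "j > n" for j
  proof -
    have "(pderiv ^^ j) (cheb n) = (0 :: real poly)"
      using that by (intro poly_eqI) (simp add: coeff_higher_pderiv coeff_eq_0)
    then show ?thesis by (simp add: a_def)
  qed
  have rec: "(2 * real k + 1) * a (Suc k) = (real n ^ 2 - real k ^ 2) * a k"
    unfolding a_def by (rule higher_pderiv_cheb_at_1)
  have IH: "0 \<le> a k" "real (odd_double_fact k) * a k \<le> real n ^ (2 * k)"
    using Suc by (simp_all add: a_def)
  have "0 \<le> a (Suc k) \<and> real (odd_double_fact (Suc k)) * a (Suc k) \<le> real n ^ (2 * Suc k)"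
  proof (cases "k \<le> n")
    case True
    then have nk: "0 \<le> real n ^ 2 - real k ^ 2" by (simp add: power_mono)
    have "0 \<le> (2 * real k + 1) * a (Suc k)" unfolding rec using nk IH by simp
    then have 1: "0 \<le> a (Suc k)" by (simp add: zero_le_mult_iff)
    have "real (odd_double_fact (Suc k)) * a (Suc k) = real (odd_double_fact k) * ((2 * real k + 1) * a (Suc k))"
      by (simp add: odd_double_fact_Suc algebra_simps)
    also have "\<dots> = (real n ^ 2 - real k ^ 2) * (real (odd_double_fact k) * a k)"
      unfolding rec by simp
    also have "\<dots> \<le> real n ^ 2 * real n ^ (2 * k)"
      using nk IH by (intro mult_mono) auto
    finally show ?thesis using 1 by (simp add: power_add power2_eq_square)
  qed (simp add: zero)
  then show "0 \<le> poly ((pderiv ^^ Suc k) (cheb n)) (1::real)"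
    "real (odd_double_fact (Suc k)) * poly ((pderiv ^^ Suc k) (cheb n)) 1 \<le> real n ^ (2 * Suc k)"
    by (simp_all only: a_def)
qed

text \<open>The affine map from \<open>[-1, 1]\<close> onto \<open>[0, L]\<close> and division by
  \<open>M\<close> reduce this to the unit case.\<close>

lemma markov_brothers:
  fixes q :: "real poly"
  assumes d: "degree q = d" "d \<ge> 1" and k: "k \<ge> 1" and L: "L > 0" and M: "M > 0"
    and bd: "\<And>x. x \<in> {0..L} \<Longrightarrow> \<bar>poly q x\<bar> \<le> M"
    and x: "x \<in> {0..L}"
  shows "\<bar>poly ((pderiv ^^ k) q) x\<bar> \<le> M * (2 / L) ^ k * poly ((pderiv ^^ k) (cheb d)) 1"
proof -
  define r where "r = smult (1 / M) (pcompose q [:L / 2, L / 2:])"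
  define a where "a = 2 * x / L - 1"
  have xa: "x = L / 2 + a * (L / 2)" using L by (simp add: a_def field_simps)
  have "\<bar>poly ((pderiv ^^ k) r) a\<bar> \<le> \<bar>poly ((pderiv ^^ k) (cheb d)) 1\<bar>"
  proof (rule markov_brothers_unit[OF d(2) _ k])
    show "degree r \<le> d" using d by (simp add: r_def degree_pcompose)
    show "\<bar>a\<bar> \<le> 1" using x L by (auto simp: a_def abs_le_iff field_simps)
    fix t :: real assume "\<bar>t\<bar> \<le> 1"
    then have "0 \<le> (1 + t) * (L / 2)" "(1 + t) * (L / 2) \<le> 2 * (L / 2)"
      using L by (auto intro!: mult_nonneg_nonneg mult_right_mono)
    then have "L / 2 + t * (L / 2) \<in> {0..L}" by (simp add: algebra_simps)
    from bd[OF this] show "\<bar>poly r t\<bar> \<le> 1"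
      using M by (simp add: r_def poly_pcompose)
  qed
  also have "\<bar>poly ((pderiv ^^ k) (cheb d)) (1::real)\<bar> = poly ((pderiv ^^ k) (cheb d)) 1"
    using higher_pderiv_cheb_at_1_bounds(1) by simp
  also have "poly ((pderiv ^^ k) r) a = (L / 2) ^ k / M * poly ((pderiv ^^ k) q) x"
    using M by (simp add: r_def higher_pderiv_smult higher_pderiv_pcompose_linear poly_pcompose xa)
  finally have "(L / 2) ^ k / M * \<bar>poly ((pderiv ^^ k) q) x\<bar> \<le> poly ((pderiv ^^ k) (cheb d)) 1"
    using M L by (simp add: abs_mult)
  then have "M * (2 / L) ^ k * ((L / 2) ^ k / M * \<bar>poly ((pderiv ^^ k) q) x\<bar>)
      \<le> M * (2 / L) ^ k * poly ((pderiv ^^ k) (cheb d)) 1"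
    using M L by (intro mult_left_mono) auto
  moreover have "M * (2 / L) ^ k * ((L / 2) ^ k / M) = 1"
    using M L by (simp add: power_divide)
  ultimately show ?thesis
    by (metis mult.assoc mult_1)
qed

section \<open>From integer points to the interval\<close>

text \<open>
  At an interior maximum of \<open>\<bar>q\<bar>\<close> the linear Taylor term vanishes, and the nearest integer is
  at distance at most \<open>1/2\<close>.
\<close>
lemma max_bound_from_integer_points:
  fixes q :: "real poly"
  assumes n: "n \<ge> 1" and d: "degree q = d" "d \<ge> 1"
    and int: "\<And>i. i \<le> n \<Longrightarrow> \<bar>poly q (real i)\<bar> \<le> B"
    and x0: "x0 \<in> {0..real n}" and M: "M = \<bar>poly q x0\<bar>" "M > 0"
    and max: "\<And>x. x \<in> {0..real n} \<Longrightarrow> \<bar>poly q x\<bar> \<le> M"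
  shows "M * (1 - (real d ^ 2 / real n) ^ 2 / 6) < B"
proof -
  define X where "X = real d ^ 2 / real n"
  have X: "X > 0" using n d by (simp add: X_def)
  show ?thesis
  \<comment> \<open>Both endpoints are integer points, so there \<open>M <= B\<close>
    directly.\<close>
  proof (cases "x0 = 0 \<or> x0 = real n")
    case True
    then have "M \<le> B" using int[of 0] int[of n] M by auto
    moreover have "M * (1 - X ^ 2 / 6) < M * 1"
      using M X by (intro mult_strict_left_mono) auto
    ultimately show ?thesis by (simp add: X_def)
  next
    case False
    then have x0': "0 < x0" "x0 < real n" using x0 by auto
    define \<sigma> where "\<sigma> = sgn (poly q x0)"
    have \<sigma>: "\<bar>\<sigma>\<bar> = 1" "\<sigma> * poly q x0 = M" using M by (auto simp: \<sigma>_def abs_sgn sgn_if split: if_splits)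
    have "\<sigma> * poly (pderiv q) x0 = 0"
    proof (rule DERIV_local_max)
      show "((\<lambda>x. \<sigma> * poly q x) has_real_derivative \<sigma> * poly (pderiv q) x0) (at x0)"
        by (intro DERIV_cmult poly_DERIV)
      show "0 < min x0 (real n - x0)" using x0' by simp
      show "\<forall>y. \<bar>x0 - y\<bar> < min x0 (real n - x0) \<longrightarrow> \<sigma> * poly q y \<le> \<sigma> * poly q x0"
      proof (intro allI impI)
        fix y assume "\<bar>x0 - y\<bar> < min x0 (real n - x0)"
        then have "y \<in> {0..real n}" by auto
        then have "\<bar>\<sigma> * poly q y\<bar> \<le> M" using max \<sigma>(1) by (simp add: abs_mult)
        then show "\<sigma> * poly q y \<le> \<sigma> * poly q x0" using \<sigma>(2) by linarith
      qed
    qed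
    then have q'0: "poly (pderiv q) x0 = 0" using \<sigma>(1) by auto
    define i where "i = nat (round x0)"
    have ri: "real i = of_int (round x0)"
      using x0' by (simp add: i_def round_def)
    have dist: "\<bar>real i - x0\<bar> \<le> 1 / 2" unfolding ri using of_int_round_abs_le[of x0] by simp
    have i_n: "i \<le> n"
    proof -
      have "real i < real n + 1" using dist x0' by linarith
      then show ?thesis by simp
    qed
    obtain t where t: "t \<in> {0..real n}"
      "poly q (real i) = poly q x0 + poly ((pderiv ^^ 2) q) t / 2 * (real i - x0) ^ 2"
    proof (cases "real i = x0")
      case True
      then show ?thesis using that[of x0] x0 by simp
    next
      case False
      obtain t where "if real i < x0 then real i < t \<and> t < x0 else x0 < t \<and> t < real i"
        "poly q (real i) = (\<Sum>m<2. poly ((pderiv ^^ m) q) x0 / fact m * (real i - x0) ^ m)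
          + poly ((pderiv ^^ 2) q) t / fact 2 * (real i - x0) ^ 2"
        using Taylor[of 2 "\<lambda>m. poly ((pderiv ^^ m) q)" "poly q" 0 "real n" x0 "real i"]
          x0 i_n False by auto
      then show ?thesis
        using that[of t] x0 i_n q'0 by (auto simp: numeral_2_eq_2 split: if_splits)
    qed
    define a2 where "a2 = poly ((pderiv ^^ 2) (cheb d)) (1::real)"
    have a2: "a2 = real d ^ 2 * (real d ^ 2 - 1) / 3"
      using higher_pderiv_cheb_at_1[of 0 d] higher_pderiv_cheb_at_1[of 1 d]
      by (simp add: a2_def numeral_2_eq_2 mult.commute)
    have "\<bar>poly ((pderiv ^^ 2) q) t\<bar> \<le> M * (2 / real n) ^ 2 * a2"
      unfolding a2_def by (rule markov_brothers[OF d _ _ M(2) max t(1)]) (use n in auto)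
    \<comment> \<open>Strictness comes from \<open>d^2 - 1 < d^2\<close>.\<close>
    also have "\<dots> < M * (2 / real n) ^ 2 * (real d ^ 4 / 3)"
    proof (intro mult_strict_left_mono)
      have "real d ^ 2 * (real d ^ 2 - 1) < real d ^ 4"
        using d by (simp add: algebra_simps power2_eq_square power4_eq_xxxx)
      then show "a2 < real d ^ 4 / 3" unfolding a2 by simp
    qed (use M n in simp)
    also have "\<dots> = 4 * M * X ^ 2 / 3"
      by (simp add: X_def power_divide power_mult[symmetric])
    finally have q2: "\<bar>poly ((pderiv ^^ 2) q) t\<bar> < 4 * M * X ^ 2 / 3" .
    have "M \<le> \<bar>poly q (real i)\<bar> + \<bar>poly ((pderiv ^^ 2) q) t / 2 * (real i - x0) ^ 2\<bar>"
      unfolding M(1) using t(2) by linarith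
    also have "\<bar>poly ((pderiv ^^ 2) q) t / 2 * (real i - x0) ^ 2\<bar> \<le> \<bar>poly ((pderiv ^^ 2) q) t\<bar> / 2 * (1 / 2) ^ 2"
    proof -
      have "\<bar>real i - x0\<bar> ^ 2 \<le> (1 / 2) ^ 2" using dist by (intro power_mono) auto
      then have "\<bar>poly ((pderiv ^^ 2) q) t / 2\<bar> * (real i - x0) ^ 2 \<le> \<bar>poly ((pderiv ^^ 2) q) t / 2\<bar> * (1 / 2) ^ 2"
        by (intro mult_left_mono) auto
      then show ?thesis by (simp add: abs_mult)
    qed
    \<comment> \<open>The constant is \<open>4/3\<close> from the derivative bound, times
      \<open>1/2\<close> from Taylor, times \<open>(1/2)^2\<close> from the distance.\<close>
    finally have "M < B + M * X ^ 2 / 6"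
      using int[OF i_n] q2 by (simp add: power2_eq_square)
    then show ?thesis by (simp add: X_def algebra_simps)
  qed
qed

theorem theorem8:
  fixes n k :: nat and c :: real and p :: "real poly"
  assumes "n \<ge> 1" and "k \<ge> 1" and "c > 0"
    and "\<forall>i\<in>{0..n}. 0 \<le> poly p (real i) \<and> poly p (real i) \<le> 1"
    and "(SUP x\<in>{0..real n}. \<bar>poly ((pderiv ^^ k) p) x\<bar>) \<ge> c"
  shows "real (degree p) ^ 2 \<ge> sqrt 6 * real n \<or>
    (let x = real (degree p) ^ 2 / real n in
       (1 - x ^ 2 / 6) * (real (odd_double_fact k) / 2 ^ (k - 1)) * c < x ^ k)"
proof (cases "real (degree p) ^ 2 \<ge> sqrt 6 * real n")
  case False
  define d where "d = degree p"
  define X where "X = real d ^ 2 / real n"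
  \<comment> \<open>Centring the values at 0 halves the bound at the integers; derivatives of order
    \<open>k >= 1\<close> are unchanged.\<close>
  define q where "q = p + [:-1/2:]"
  obtain j where j: "k = Suc j" using assms(2) by (cases k) auto
  have Dq: "(pderiv ^^ k) q = (pderiv ^^ k) p"
    by (simp add: j q_def funpow_swap1 pderiv_add pderiv_pCons)
  \<comment> \<open>For constant \<open>p\<close> the supremum would be 0, against
    \<open>c > 0\<close>.\<close>
  have d1: "d \<ge> 1"
  proof (rule ccontr)
    assume "\<not> d \<ge> 1"
    then have "(pderiv ^^ k) p = 0"
      using assms(2) by (intro poly_eqI) (simp add: coeff_higher_pderiv coeff_eq_0 d_def)
    then show False using assms(1,3,5) by simp
  qed
  have degq: "degree q = d"
    using degree_add_eq_left[of "[:-1/2:]" p] d1 by (simp add: q_def d_def)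
  have int: "\<bar>poly q (real i)\<bar> \<le> 1 / 2" if "i \<le> n" for i
  proof -
    have "\<bar>poly p (real i) - 1 / 2\<bar> \<le> 1 / 2"
      using bspec[OF assms(4), of i] that unfolding abs_le_iff by simp
    then show ?thesis by (simp add: q_def)
  qed
  have "continuous_on {0..real n} (\<lambda>x. \<bar>poly q x\<bar>)"
    by (intro continuous_intros)
  then obtain x0 where x0: "x0 \<in> {0..real n}"
    and max: "\<And>x. x \<in> {0..real n} \<Longrightarrow> \<bar>poly q x\<bar> \<le> \<bar>poly q x0\<bar>"
    using continuous_attains_sup[of "{0..real n}" "\<lambda>x. \<bar>poly q x\<bar>"] by auto
  define M where "M = \<bar>poly q x0\<bar>"
  have M: "M > 0"
  proof (rule ccontr)
    assume "\<not> M > 0"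
    then have "{0..real n} \<subseteq> {x. poly q x = 0}" using max by (auto simp: M_def)
    moreover have "finite {x. poly q x = 0}" using degq d1 by (intro poly_roots_finite) auto
    ultimately have "finite {0..real n}" by (rule finite_subset)
    then show False using assms(1) by (simp add: infinite_Icc)
  qed
  have MX: "M * (1 - X ^ 2 / 6) < 1 / 2"
    unfolding X_def
    by (rule max_bound_from_integer_points[OF assms(1) degq d1 int x0 M_def M max[folded M_def]])
  define F where "F = real (odd_double_fact k)"
  have F: "F > 0" using odd_double_fact_pos[of k] by (simp add: F_def)
  have X: "X > 0" using assms(1) d1 by (simp add: X_def)
  have "c \<le> M * (2 / real n) ^ k * poly ((pderiv ^^ k) (cheb d)) 1"
    using assms(1)
    by (intro order_trans[OF assms(5)] cSUP_least)
       (auto simp flip: Dq intro!: markov_brothers[OF degq d1 assms(2) _ M max[folded M_def]])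
  then have "F * c \<le> F * (M * (2 / real n) ^ k * poly ((pderiv ^^ k) (cheb d)) 1)"
    using F by (intro mult_left_mono) auto
  also have "\<dots> = M * (2 / real n) ^ k * (F * poly ((pderiv ^^ k) (cheb d)) 1)"
    by simp
  also have "\<dots> \<le> M * (2 / real n) ^ k * real d ^ (2 * k)"
    unfolding F_def using M by (intro mult_left_mono higher_pderiv_cheb_at_1_bounds) auto
  also have "\<dots> = 2 ^ (k - 1) * (2 * M * X ^ k)"
    by (simp add: X_def power_divide power_mult j power2_eq_square)
  finally have "F / 2 ^ (k - 1) * c \<le> 2 * M * X ^ k"
    by (simp add: field_simps)
  \<comment> \<open>The case assumption enters here: the factor must be nonnegative to multiply the
    inequality by it.\<close>
  moreover have "1 - X ^ 2 / 6 \<ge> 0"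
  proof -
    have "X < sqrt 6" using False assms(1) by (simp add: X_def d_def field_simps)
    then have "X ^ 2 < (sqrt 6) ^ 2" using X by (intro power_strict_mono) auto
    then show ?thesis by simp
  qed
  ultimately have "(1 - X ^ 2 / 6) * (F / 2 ^ (k - 1) * c) \<le> (1 - X ^ 2 / 6) * (2 * M * X ^ k)"
    by (rule mult_left_mono)
  also have "\<dots> = (M * (1 - X ^ 2 / 6)) * (2 * X ^ k)" by simp
  also have "\<dots> < 1 / 2 * (2 * X ^ k)"
    using MX X by (intro mult_strict_right_mono) auto
  finally show ?thesis by (simp add: X_def F_def d_def Let_def mult.assoc)
qed simp

end
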